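(* Let $(M,\hat{J},\hat{\theta})$ and $(N,\widetilde{J},\widetilde{\theta})$ be two vertical, simply connected pseudohermitian submanifolds of $H_{n}$ without flat points, both of CR dimension $m=n-1$. If there exists a pseudohermitian transformation $\phi:M\rightarrow N$, then $\phi=\Phi|_{M}$ for some Heisenberg rigid motion $\Phi$.
   Context: $H_{n}$ is the Heisenberg group with contact form $\Theta=dt+\sum_{\beta}(x_\beta dy_\beta-y_\beta dx_\beta)$, contact bundle $\xi=\ker\Theta$, standard CR structure $J$, Reeb field $T=\partial_t$ and Levi metric; a Heisenberg rigid motion is an element of the group $PSH(n)$ of pseudohermitian transformations of $H_n$. A pseudohermitian submanifold $(M,\hat J,\hat\theta)$ satisfies $\hat{\xi}=TM\cap\xi$, $\hat{J}=J|_{\hat{\xi}}$, $\hat{\theta}=\Theta|_{M}$. It is vertical if $T$ is tangent to $M$ everywhere (the fundamental vector field $\nu$, the unique section of $\hat\xi^\perp$ with $T+\nu\in TM$, vanishes). With a Darboux frame $Z_j\in\hat\xi_{1,0}$, $Z_a\in\hat\xi^\perp_{1,0}$ and pseudohermitian connection forms $\theta_\gamma{}^\beta$ of $H_n$, the second fundamental form is $II=\theta^{j}\otimes\theta_{j}{}^{a}\otimes Z_{a}$; a flat point of a vertical pseudohermitian submanifold is a point where $II=0$. A pseudohermitian transformation $\phi:M\to N$ is a diffeomorphism with $\phi_*\circ\hat J=\widetilde J\circ\phi_*$ and $\phi^*\widetilde\theta=\hat\theta$. *)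

theory Defs
  imports "HOL-Analysis.Analysis"
begin

text \<open>The Heisenberg group H_n is modelled as C^n x R with points (z, t),
  n = CARD('n). Tangent vectors at a point are elements of the same space.\<close>

type_synonym 'n heis = "(complex ^ 'n) \<times> real"

fun smooth_k :: "nat \<Rightarrow> 'a::real_normed_vector set \<Rightarrow> ('a \<Rightarrow> 'b::real_normed_vector) \<Rightarrow> bool" where
  "smooth_k 0 U f = continuous_on U f"
| "smooth_k (Suc k) U f =
     (continuous_on U f \<and> (\<forall>x\<in>U. f differentiable (at x)) \<and>
      (\<forall>v. smooth_k k U (\<lambda>x. frechet_derivative f (at x) v)))"

definition smooth_on :: "'a::real_normed_vector set \<Rightarrow> ('a \<Rightarrow> 'b::real_normed_vector) \<Rightarrow> bool" where
  "smooth_on U f \<longleftrightarrow> open U \<and> (\<forall>k. smooth_k k U f)"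

definition submanifold :: "nat \<Rightarrow> 'a::euclidean_space set \<Rightarrow> bool" where
  "submanifold d M \<longleftrightarrow>
    (\<forall>p\<in>M. \<exists>U V (\<phi>::'a \<Rightarrow> 'a) (\<psi>::'a \<Rightarrow> 'a) L.
        p \<in> U \<and> smooth_on U \<phi> \<and> smooth_on V \<psi> \<and> \<phi> ` U = V \<and>
        (\<forall>x\<in>U. \<psi> (\<phi> x) = x) \<and> (\<forall>y\<in>V. \<phi> (\<psi> y) = y) \<and>
        subspace L \<and> dim L = d \<and> \<phi> ` (M \<inter> U) = V \<inter> L)"

definition tangent_space :: "'a::euclidean_space set \<Rightarrow> 'a \<Rightarrow> 'a set" where
  "tangent_space M p = {v. \<exists>(\<gamma>::real \<Rightarrow> 'a) e. 0 < e \<and> smooth_on {-e<..<e} \<gamma> \<and> \<gamma> 0 = p \<and>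
       (\<forall>t\<in>{-e<..<e}. \<gamma> t \<in> M) \<and> (\<gamma> has_vector_derivative v) (at 0)}"

definition smooth_map_on :: "'a::euclidean_space set \<Rightarrow> ('a \<Rightarrow> 'b::euclidean_space) \<Rightarrow> bool" where
  "smooth_map_on M f \<longleftrightarrow> (\<forall>p\<in>M. \<exists>U F. p \<in> U \<and> smooth_on U F \<and> (\<forall>q\<in>M \<inter> U. F q = f q))"

definition diffeo_betw :: "'a::euclidean_space set \<Rightarrow> 'b::euclidean_space set \<Rightarrow> ('a \<Rightarrow> 'b) \<Rightarrow> bool" where
  "diffeo_betw M N f \<longleftrightarrow> bij_betw f M N \<and> smooth_map_on M f \<and> smooth_map_on N (inv_into M f)"

text \<open>Contact form Theta = dt + sum (x dy - y dx), evaluated at p on the vector v.\<close>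
definition Theta :: "'n::finite heis \<Rightarrow> 'n heis \<Rightarrow> real" where
  "Theta p v = snd v + (\<Sum>\<beta>\<in>UNIV. Im (cnj (fst p $ \<beta>) * (fst v $ \<beta>)))"

definition xi :: "'n::finite heis \<Rightarrow> 'n heis set" where
  "xi p = {v. Theta p v = 0}"

text \<open>Standard CR structure J on xi: J X_b = Y_b, J Y_b = - X_b, where
  X_b = d/dx_b + y_b d/dt, Y_b = d/dy_b - x_b d/dt.\<close>
definition Jst :: "'n::finite heis \<Rightarrow> 'n heis \<Rightarrow> 'n heis" where
  "Jst p v = ((\<chi> \<beta>. \<i> * (fst v $ \<beta>)), - (\<Sum>\<beta>\<in>UNIV. Re (cnj (fst p $ \<beta>) * (fst v $ \<beta>))))"

definition Reeb :: "'n::finite heis" where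
  "Reeb = (0, 1)"

definition dTheta :: "'n::finite heis \<Rightarrow> 'n heis \<Rightarrow> real" where
  "dTheta v w = 2 * (\<Sum>\<beta>\<in>UNIV. Re (fst v $ \<beta>) * Im (fst w $ \<beta>) - Im (fst v $ \<beta>) * Re (fst w $ \<beta>))"

definition levi :: "'n::finite heis \<Rightarrow> 'n heis \<Rightarrow> 'n heis \<Rightarrow> real" where
  "levi p v w = dTheta v (Jst p w)"

text \<open>Pseudohermitian (Tanaka-Webster) connection of H_n: the frame X_b, Y_b, T is
  parallel. A vector field X = sum a_b X_b + b_b Y_b + c T has C^n-part a + i b
  (the z-component of X) and c = Theta(X); nabla_Y X at p differentiates these coefficients.\<close>
definition hlift :: "'n::finite heis \<Rightarrow> complex ^ 'n \<Rightarrow> 'n heis" where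
  "hlift p w = (w, - (\<Sum>\<beta>\<in>UNIV. Im (cnj (fst p $ \<beta>) * (w $ \<beta>))))"

definition ps_nabla :: "'n::finite heis \<Rightarrow> ('n heis \<Rightarrow> 'n heis) \<Rightarrow> 'n heis \<Rightarrow> 'n heis" where
  "ps_nabla p X Y = hlift p (fst (frechet_derivative X (at p) Y))
      + (frechet_derivative (\<lambda>q. Theta q (X q)) (at p) Y) *\<^sub>R Reeb"

definition xi_hat :: "'n::finite heis set \<Rightarrow> 'n heis \<Rightarrow> 'n heis set" where
  "xi_hat M p = tangent_space M p \<inter> xi p"

definition xi_perp :: "'n::finite heis set \<Rightarrow> 'n heis \<Rightarrow> 'n heis set" where
  "xi_perp M p = {v \<in> xi p. \<forall>w\<in>xi_hat M p. levi p v w = 0}"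

text \<open>(M, J|xi_hat, Theta|M) is a pseudohermitian submanifold of CR dimension m:
  M is a (2m+1)-dimensional submanifold, xi_hat = TM cap xi is J-invariant of real rank 2m.\<close>
definition ph_submanifold :: "nat \<Rightarrow> 'n::finite heis set \<Rightarrow> bool" where
  "ph_submanifold m M \<longleftrightarrow> submanifold (2 * m + 1) M \<and>
     (\<forall>p\<in>M. Jst p ` xi_hat M p \<subseteq> xi_hat M p \<and> dim (xi_hat M p) = 2 * m)"

definition vertical :: "'n::finite heis set \<Rightarrow> bool" where
  "vertical M \<longleftrightarrow> (\<forall>p\<in>M. Reeb \<in> tangent_space M p)"

text \<open>Flat point: the second fundamental form II(Y, X) = (nabla_Y X)^perp vanishes at p
  for all tangent Y and all smooth sections X of xi_hat (given by local ambient extensions).\<close>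
definition flat_point :: "'n::finite heis set \<Rightarrow> 'n heis \<Rightarrow> bool" where
  "flat_point M p \<longleftrightarrow>
    (\<forall>U X. p \<in> U \<and> smooth_on U X \<and> (\<forall>q\<in>M \<inter> U. X q \<in> xi_hat M q) \<longrightarrow>
       (\<forall>Y\<in>tangent_space M p. \<forall>\<nu>\<in>xi_perp M p. levi p (ps_nabla p X Y) \<nu> = 0))"

text \<open>Pseudohermitian transformation: a diffeomorphism with phi_* o J = J o phi_* on xi_hat
  and phi^* Theta = Theta; the differential is computed from any local smooth extension.\<close>
definition ph_transformation :: "'n::finite heis set \<Rightarrow> 'n heis set \<Rightarrow> ('n heis \<Rightarrow> 'n heis) \<Rightarrow> bool" where
  "ph_transformation M N \<phi> \<longleftrightarrow> diffeo_betw M N \<phi> \<and>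
    (\<forall>p\<in>M. \<forall>U F. p \<in> U \<and> smooth_on U F \<and> (\<forall>q\<in>M \<inter> U. F q = \<phi> q) \<longrightarrow>
       (\<forall>v\<in>tangent_space M p. Theta (\<phi> p) (frechet_derivative F (at p) v) = Theta p v) \<and>
       (\<forall>v\<in>xi_hat M p. frechet_derivative F (at p) (Jst p v) = Jst (\<phi> p) (frechet_derivative F (at p) v)))"

definition PSH :: "('n::finite heis \<Rightarrow> 'n heis) set" where
  "PSH = {\<Phi>. ph_transformation UNIV UNIV \<Phi>}"

end

theory Submission
  imports Defs "HOL-Complex_Analysis.Conformal_Mappings"
begin

text \<open>Since \<open>M\<close> is vertical, its projection to \<open>C^n\<close> is locally a complex hypersurface, and \<open>\<phi>\<close> preserves
  \<open>\<Theta>\<close>, hence \<open>d\<Theta>\<close>, the Reeb field and the Levi metric; it therefore induces a local holomorphic isometry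
  of the projections. As in Calabi's rigidity theorem such a map preserves Euclidean distances: two points of a
  graph chart lie on a holomorphic curve, its image has the same speed, and polarising the
  equality of speeds by the identity theorem equates the chords. So the induced map is locally the
  restriction of a real affine isometry. Without flat points the tangent spaces span \<open>C^n\<close>, which
  makes this isometry complex linear and unique; the \<open>t\<close>-component is then determined by \<open>\<Theta>\<close> up to a
  constant, and connectedness of \<open>M\<close> glues the local rigid motions.\<close>

section \<open>Smooth maps and second derivatives\<close>

text \<open>An isometry between real submanifolds does not control chords. Here the metric comes
  with a complex structure, so the speeds along a holomorphic curve determine the products of its
  velocities at two different parameters. One complex variable suffices, because only pairs of
  points have to be compared.

  The second fundamental forms of \<open>M\<close> and \<open>N\<close> are never matched against
  each other. Flatness enters through codimension one: a normal common to all tangent spaces near a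
  point would freeze the complex tangent space there and force \<open>II = 0\<close> at that point.

  The projection of \<open>M\<close> to \<open>C^n\<close> is never formed as a manifold. A vertical
  tangent space is the full preimage of its projection, so the transfer to \<open>C^n\<close> takes
  place on tangent vectors and on curves.

  \<open>\<phi>\<close> is differentiated only through ambient extensions, and
  \<open>\<Theta>\<close> is known to be preserved only on vectors tangent to \<open>M\<close>.
  Preservation of \<open>d\<Theta>\<close> is therefore proved in a chart, where \<open>M\<close>
  becomes a linear subspace, and rests on the symmetry of second derivatives.\<close>

lemma smooth_on_has_derivative:
  assumes "smooth_on U f" "x \<in> U"
  shows "(f has_derivative frechet_derivative f (at x)) (at x)"
proof -
  have "smooth_k (Suc 0) U f"
    using assms unfolding smooth_on_def by blast
  then show ?thesis
    using assms(2) by (simp add: frechet_derivative_works)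
qed

lemma smooth_on_deriv_continuous:
  assumes "smooth_on U f"
  shows "continuous_on U (\<lambda>x. frechet_derivative f (at x) v)"
proof -
  have "smooth_k (Suc 0) U f"
    using assms unfolding smooth_on_def by blast
  then show ?thesis by simp
qed

lemma smooth_on_deriv_differentiable:
  assumes "smooth_on U f" "x \<in> U"
  shows "(\<lambda>x. frechet_derivative f (at x) v) differentiable (at x)"
proof -
  have "smooth_k (Suc (Suc 0)) U f"
    using assms unfolding smooth_on_def by blast
  then show ?thesis using assms(2) by simp
qed

lemma frechet_derivative_cong_open:
  assumes "open W" "x \<in> W" "\<And>y. y \<in> W \<Longrightarrow> f y = g y"
  shows "frechet_derivative f (at x) = frechet_derivative g (at x)"
proof -
  have "(f has_derivative D) (at x) \<longleftrightarrow> (g has_derivative D) (at x)" for D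
    by (metis assms has_derivative_transform_within_open)
  then show ?thesis by (simp add: frechet_derivative_def)
qed

lemma smooth_k_cong:
  assumes "open W" "smooth_k k W f" "\<And>x. x \<in> W \<Longrightarrow> f x = g x"
  shows "smooth_k k W g"
  using assms(2,3)
proof (induction k arbitrary: f g)
  case 0
  then show ?case by (metis continuous_on_cong smooth_k.simps(1))
next
  case (Suc k)
  have d: "frechet_derivative f (at x) = frechet_derivative g (at x)" if "x \<in> W" for x
    using frechet_derivative_cong_open[OF \<open>open W\<close> that] Suc.prems(2) by blast
  have "smooth_k k W (\<lambda>x. frechet_derivative g (at x) v)" for v
    by (rule Suc.IH[of "\<lambda>x. frechet_derivative f (at x) v"]) (use Suc.prems d in auto)
  moreover have "g differentiable (at x)" if "x \<in> W" for x
    using Suc.prems that assms(1) unfolding differentiable_def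
    by (metis (no_types, lifting) differentiable_def has_derivative_transform_within_open smooth_k.simps(2))
  moreover have "continuous_on W g"
    using Suc.prems by (metis continuous_on_cong smooth_k.simps(2))
  ultimately show ?case by simp
qed

text \<open>With an affine inner map the derivative of the composite has the same form with the
  constant direction \<open>L v\<close>, so the induction on \<open>k\<close> closes. It supplies
  the smooth curves, straight in a chart, that realise tangent vectors.\<close>

lemma smooth_k_compose_affine:
  assumes "open W" "bounded_linear L" "\<And>x. x \<in> W \<Longrightarrow> c + L x \<in> U" "smooth_k k U f"
  shows "smooth_k k W (\<lambda>x. f (c + L x))"
  using assms(4)
proof (induction k arbitrary: f)
  case 0
  interpret bounded_linear L by fact
  have "continuous_on W (\<lambda>x. c + L x)" 
    by (intro continuous_intros linear_continuous_on assms)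
  then show ?case using 0 assms(3)
    by (auto intro!: continuous_on_compose2[of U f])
next
  case (Suc k)
  have der: "((\<lambda>x. f (c + L x)) has_derivative (\<lambda>v. frechet_derivative f (at (c + L x)) (L v))) (at x)"
    if "x \<in> W" for x
  proof -
    have 1: "(f has_derivative frechet_derivative f (at (c + L x))) (at (c + L x))"
      using Suc.prems assms(3)[OF that] by (simp add: frechet_derivative_works)
    have 2: "((\<lambda>x. c + L x) has_derivative L) (at x)"
      using bounded_linear_imp_has_derivative[OF assms(2)] 
      by (auto intro!: derivative_eq_intros)
    show ?thesis using has_derivative_compose[OF 2 1] .
  qed
  have "smooth_k k W (\<lambda>x. frechet_derivative (\<lambda>x. f (c + L x)) (at x) v)" for v
  proof (rule smooth_k_cong[OF assms(1)])
    show "smooth_k k W (\<lambda>x. frechet_derivative f (at (c + L x)) (L v))"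
      using Suc.IH[of "\<lambda>x. frechet_derivative f (at x) (L v)"] Suc.prems by simp
  qed (use der frechet_derivative_at in metis)
  moreover have "continuous_on W (\<lambda>x. f (c + L x))"
    using der by (meson continuous_at_imp_continuous_on has_derivative_continuous)
  ultimately show ?case
    using der by (auto simp: differentiable_def)
qed

lemma smooth_k_const: "smooth_k k U (\<lambda>x. c)"
  by (induction k arbitrary: c) (auto simp: frechet_derivative_const)

lemma smooth_on_affine:
  fixes L :: "'a::real_normed_vector \<Rightarrow> 'b::real_normed_vector"
  assumes "bounded_linear L"
  shows "smooth_on UNIV (\<lambda>x. c + L x)"
proof -
  have D: "((\<lambda>x. c + L x) has_derivative L) (at x)" for x
    using bounded_linear_imp_has_derivative[OF assms] by (auto intro!: derivative_eq_intros)
  have F: "frechet_derivative (\<lambda>x. c + L x) (at x) = L" for x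
    using frechet_derivative_at[OF D] by metis
  have "smooth_k k UNIV (\<lambda>x. c + L x)" for k
  proof (cases k)
    case 0
    have "continuous_on UNIV (\<lambda>x. c + L x)"
      using D by (meson continuous_at_imp_continuous_on has_derivative_continuous)
    then show ?thesis using 0 by simp
  next
    case (Suc k)
    have "continuous_on UNIV (\<lambda>x. c + L x)"
      using D by (meson continuous_at_imp_continuous_on has_derivative_continuous)
    then show ?thesis using Suc D by (auto simp: F smooth_k_const differentiable_def)
  qed
  then show ?thesis by (simp add: smooth_on_def)
qed

text \<open>The mean value theorem along \<open>v\<close> turns the second difference into
  \<open>t\<close> times the increment of \<open>y \<mapsto> f' y v\<close> between two points that
  differ by \<open>t *\<^sub>R w\<close>. Differentiability of that function at the single point
  \<open>x\<close> then gives the limit.\<close>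

lemma second_difference_quotient:
  fixes f :: "'a::real_normed_vector \<Rightarrow> real"
  assumes V: "open V" "x \<in> V" "\<And>y. y \<in> V \<Longrightarrow> (f has_derivative f' y) (at y)"
    and D: "((\<lambda>y. f' y v) has_derivative B) (at x)"
  shows "((\<lambda>t. (f (x + t *\<^sub>R v + t *\<^sub>R w) - f (x + t *\<^sub>R v) - f (x + t *\<^sub>R w) + f x) / t\<^sup>2)
           \<longlongrightarrow> B w) (at_right 0)"
proof (rule tendstoI)
  fix e :: real assume e: "e > 0"
  define K where "K = norm v + norm w + 1"
  have K: "K > 0" unfolding K_def by (smt (verit) norm_ge_zero)
  \<comment> \<open>Two errors of size \<open>\<epsilon> * (t * K)\<close> occur below; divided by
    \<open>t\<close> they add up to \<open>e / 2\<close>, which keeps the final inequality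
    strict.\<close>
  define \<epsilon> where "\<epsilon> = e / (4 * K)"
  have eps: "\<epsilon> > 0" using e K by (simp add: \<epsilon>_def)
  have B: "bounded_linear B" using D has_derivative_bounded_linear by blast
  interpret bounded_linear B by (rule B)
  obtain d1 where d1: "d1 > 0" "\<And>h. norm h < d1 \<Longrightarrow> x + h \<in> V"
    using V(1,2) unfolding open_dist dist_norm by (metis add_diff_cancel_left')
  obtain d2 where d2: "d2 > 0"
     "\<And>y. norm (y - x) < d2 \<Longrightarrow> norm (f' y v - f' x v - B (y - x)) \<le> \<epsilon> * norm (y - x)"
    using D eps unfolding has_derivative_at_alt by blast
  define d where "d = min d1 d2 / K"
  have dpos: "d > 0" using d1(1) d2(1) K by (simp add: d_def)
  have main: "dist ((f (x + t *\<^sub>R v + t *\<^sub>R w) - f (x + t *\<^sub>R v) - f (x + t *\<^sub>R w) + f x) / t\<^sup>2) (B w) < e"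
    if t: "0 < t" "t < d" for t
  proof -
    have tK: "t * K < min d1 d2" using t K by (simp add: d_def field_simps)
    have small: "norm (s *\<^sub>R v + r *\<^sub>R w) \<le> t * K" if "0 \<le> s" "s \<le> t" "0 \<le> r" "r \<le> t" for s r
    proof -
      have "norm (s *\<^sub>R v + r *\<^sub>R w) \<le> s * norm v + r * norm w"
        using norm_triangle_ineq[of "s *\<^sub>R v" "r *\<^sub>R w"] that by simp
      also have "\<dots> \<le> t * norm v + t * norm w"
        using that by (intro add_mono mult_right_mono) auto
      also have "\<dots> \<le> t * K" using t by (simp add: K_def algebra_simps)
      finally show ?thesis .
    qed
    have inV: "x + s *\<^sub>R v + r *\<^sub>R w \<in> V" if "0 \<le> s" "s \<le> t" "0 \<le> r" "r \<le> t" for s r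
      using d1(2)[of "s *\<^sub>R v + r *\<^sub>R w"] small[OF that] tK by (simp add: add.assoc)
    define g where "g s = f (x + s *\<^sub>R v + t *\<^sub>R w) - f (x + s *\<^sub>R v)" for s
    have gd: "(g has_real_derivative (f' (x + s *\<^sub>R v + t *\<^sub>R w) v - f' (x + s *\<^sub>R v) v)) (at s)"
      if "0 \<le> s" "s \<le> t" for s
    proof -
      have A: "((\<lambda>s. f (x + s *\<^sub>R v + r *\<^sub>R w)) has_derivative (\<lambda>h. h * f' (x + s *\<^sub>R v + r *\<^sub>R w) v)) (at s)"
        if "0 \<le> r" "r \<le> t" for r
      proof -
        have d: "(f has_derivative f' (x + s *\<^sub>R v + r *\<^sub>R w)) (at (x + s *\<^sub>R v + r *\<^sub>R w))"
          using V(3) inV \<open>0 \<le> s\<close> \<open>s \<le> t\<close> that by blast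
        have "((\<lambda>s. x + s *\<^sub>R v + r *\<^sub>R w) has_derivative (\<lambda>h. h *\<^sub>R v)) (at s)"
          by (auto intro!: derivative_eq_intros)
        from has_derivative_compose[OF this d]
        show ?thesis using linear_simps(5)[OF has_derivative_bounded_linear[OF d]] by simp
      qed
      have "(g has_derivative (\<lambda>h. h * f' (x + s *\<^sub>R v + t *\<^sub>R w) v - h * f' (x + s *\<^sub>R v) v)) (at s)"
        unfolding g_def using has_derivative_diff[OF A[of t] A[of 0]] t by simp
      moreover have "(\<lambda>h. h * f' (x + s *\<^sub>R v + t *\<^sub>R w) v - h * f' (x + s *\<^sub>R v) v)
          = (*) (f' (x + s *\<^sub>R v + t *\<^sub>R w) v - f' (x + s *\<^sub>R v) v)"
        by (rule ext) (simp add: algebra_simps)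
      ultimately show ?thesis
        by (simp add: has_field_derivative_def)
    qed
    obtain s where s: "0 < s" "s < t" and
      gs: "g t - g 0 = (t - 0) * (f' (x + s *\<^sub>R v + t *\<^sub>R w) v - f' (x + s *\<^sub>R v) v)"
      using MVT2[OF t(1) gd] by blast
    have n1: "norm (s *\<^sub>R v + t *\<^sub>R w) \<le> t * K" "norm (s *\<^sub>R v) \<le> t * K"
      using small[of s t] small[of s 0] s t by auto
    have e1: "\<bar>f' (x + s *\<^sub>R v + t *\<^sub>R w) v - f' x v - B (s *\<^sub>R v + t *\<^sub>R w)\<bar> \<le> \<epsilon> * (t * K)"
    proof -
      have "\<bar>f' (x + s *\<^sub>R v + t *\<^sub>R w) v - f' x v - B (s *\<^sub>R v + t *\<^sub>R w)\<bar> \<le> \<epsilon> * norm (s *\<^sub>R v + t *\<^sub>R w)"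
        using d2(2)[of "x + s *\<^sub>R v + t *\<^sub>R w"] n1 tK by (simp add: add.assoc)
      also have "\<dots> \<le> \<epsilon> * (t * K)" using n1 eps by (intro mult_left_mono) auto
      finally show ?thesis .
    qed
    have e2: "\<bar>f' (x + s *\<^sub>R v) v - f' x v - B (s *\<^sub>R v)\<bar> \<le> \<epsilon> * (t * K)"
    proof -
      have "\<bar>f' (x + s *\<^sub>R v) v - f' x v - B (s *\<^sub>R v)\<bar> \<le> \<epsilon> * norm (s *\<^sub>R v)"
        using d2(2)[of "x + s *\<^sub>R v"] n1 tK by simp
      also have "\<dots> \<le> \<epsilon> * (t * K)" using n1 eps by (intro mult_left_mono) auto
      finally show ?thesis .
    qed
    define \<Delta> where "\<Delta> = f' (x + s *\<^sub>R v + t *\<^sub>R w) v - f' (x + s *\<^sub>R v) v"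
    have "\<bar>\<Delta> - t * B w\<bar> \<le> 2 * \<epsilon> * (t * K)"
      using e1 e2 by (simp add: add scaleR \<Delta>_def)
    also have "\<dots> = e * t / 2" using K by (simp add: \<epsilon>_def)
    finally have "\<bar>\<Delta> - t * B w\<bar> / t \<le> e / 2" using t by (simp add: field_simps)
    moreover have "\<Delta> / t - B w = (\<Delta> - t * B w) / t" using t by (simp add: field_simps)
    ultimately have "\<bar>\<Delta> / t - B w\<bar> \<le> e / 2"
      using t by (simp add: abs_divide)
    moreover have "(f (x + t *\<^sub>R v + t *\<^sub>R w) - f (x + t *\<^sub>R v) - f (x + t *\<^sub>R w) + f x) / t\<^sup>2 = \<Delta> / t"
    proof -
      have "f (x + t *\<^sub>R v + t *\<^sub>R w) - f (x + t *\<^sub>R v) - f (x + t *\<^sub>R w) + f x = t * \<Delta>"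
        using gs by (simp add: g_def \<Delta>_def)
      then show ?thesis using t by (simp add: power2_eq_square)
    qed
    ultimately show ?thesis using e by (simp add: dist_real_def)
  qed
  show "\<forall>\<^sub>F t in at_right 0. dist ((f (x + t *\<^sub>R v + t *\<^sub>R w) - f (x + t *\<^sub>R v) - f (x + t *\<^sub>R w) + f x) / t\<^sup>2) (B w) < e"
    unfolding eventually_at_right_field using main dpos by (meson less_trans)
qed

text \<open>The second difference is symmetric in \<open>v\<close> and \<open>w\<close>, so its
  limit can be computed in either order. Components along a basis reduce to real values, where the
  mean value theorem is available.\<close>

lemma second_derivative_symmetric:
  fixes f :: "'a::real_normed_vector \<Rightarrow> 'b::euclidean_space"
  assumes V: "open V" "x \<in> V" "\<And>y. y \<in> V \<Longrightarrow> (f has_derivative f' y) (at y)"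
    and Dv: "((\<lambda>y. f' y v) has_derivative Bv) (at x)"
    and Dw: "((\<lambda>y. f' y w) has_derivative Bw) (at x)"
  shows "Bv w = Bw v"
proof (rule euclidean_eqI)
  fix b :: 'b assume "b \<in> Basis"
  let ?g = "\<lambda>y. f y \<bullet> b"
  have d: "\<And>y. y \<in> V \<Longrightarrow> (?g has_derivative (\<lambda>h. f' y h \<bullet> b)) (at y)"
    using V(3) by (auto intro!: derivative_eq_intros)
  have 1: "((\<lambda>y. f' y v \<bullet> b) has_derivative (\<lambda>h. Bv h \<bullet> b)) (at x)"
    "((\<lambda>y. f' y w \<bullet> b) has_derivative (\<lambda>h. Bw h \<bullet> b)) (at x)"
    using Dv Dw by (auto intro!: derivative_eq_intros)
  note l1 = second_difference_quotient[OF V(1,2) d 1(1), of w]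
  note l2 = second_difference_quotient[OF V(1,2) d 1(2), of v]
  have "((\<lambda>t. (?g (x + t *\<^sub>R v + t *\<^sub>R w) - ?g (x + t *\<^sub>R v) - ?g (x + t *\<^sub>R w) + ?g x) / t\<^sup>2)
           \<longlongrightarrow> Bw v \<bullet> b) (at_right 0)"
    using l2 by (simp add: algebra_simps)
  with l1 show "Bv w \<bullet> b = Bw v \<bullet> b"
    using tendsto_unique[OF trivial_limit_at_right_real] by blast
qed

section \<open>Holomorphic curves of equal speed\<close>

text \<open>Integrating the kernel \<open>a' x \<bullet> a' y\<close> over \<open>x\<close> and then
  over \<open>y\<close> gives the squared chord. Each integration is expressed as the vanishing of
  the derivative of a difference.\<close>

lemma real_curve_chord_eq:
  fixes a b :: "real \<Rightarrow> 'a::real_inner"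
  assumes a: "\<And>x. x \<in> {0..1} \<Longrightarrow> (a has_vector_derivative a' x) (at x within {0..1})"
    and b: "\<And>x. x \<in> {0..1} \<Longrightarrow> (b has_vector_derivative b' x) (at x within {0..1})"
    and ip: "\<And>x y. x \<in> {0..1} \<Longrightarrow> y \<in> {0..1} \<Longrightarrow> a' x \<bullet> a' y = b' x \<bullet> b' y"
  shows "norm (a 1 - a 0) = norm (b 1 - b 0)"
proof -
  have half: "(a 1 - a 0) \<bullet> a' y = (b 1 - b 0) \<bullet> b' y" if y: "y \<in> {0..1}" for y
  proof -
    have "((\<lambda>x. a x \<bullet> a' y - b x \<bullet> b' y) has_derivative (\<lambda>h. 0)) (at x within {0..1})" if "x \<in> {0..1}" for x
      using a[OF that] b[OF that] ip[OF that y] unfolding has_vector_derivative_def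
      by (auto intro!: derivative_eq_intros)
    from has_derivative_zero_unique[OF _ this, of 0 1]
    show ?thesis by (simp add: algebra_simps)
  qed
  have "((\<lambda>x. (a 1 - a 0) \<bullet> a x - (b 1 - b 0) \<bullet> b x) has_derivative (\<lambda>h. 0)) (at x within {0..1})"
    if "x \<in> {0..1}" for x
    using a[OF that] b[OF that] half[OF that] unfolding has_vector_derivative_def
    by (auto intro!: derivative_eq_intros)
  from has_derivative_zero_unique[OF _ this, of 0 1]
  have "(a 1 - a 0) \<bullet> (a 1 - a 0) = (b 1 - b 0) \<bullet> (b 1 - b 0)" by (simp add: algebra_simps)
  then show ?thesis by (simp add: norm_eq_sqrt_inner)
qed

lemma cvec_inner: "(x::complex^'n) \<bullet> y = Re (\<Sum>i\<in>UNIV. x $ i * cnj (y $ i))"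
  by (simp add: inner_vec_def inner_complex_def)

text \<open>The two conjugations cancel. The point \<open>c - cnj u\<close> is the mirror image of
  \<open>c + u\<close> in the vertical line through \<open>c\<close>; on that line the two points
  coincide, so a Hermitian product of values at them becomes a squared norm.\<close>

lemma reflected_holomorphic:
  assumes "f holomorphic_on S" "open S"
  shows "(\<lambda>u. cnj (f (c - cnj u))) holomorphic_on {u. c - cnj u \<in> S}"
proof -
  let ?T = "{u. c - cnj u \<in> S}"
  have "continuous_on UNIV (\<lambda>u. c - cnj u)" by (intro continuous_intros)
  then have op: "open ?T"
    using continuous_open_preimage[of UNIV "\<lambda>u. c - cnj u" S] assms(2)
    by (simp add: vimage_def)
  have "(\<lambda>u. cnj (f (c - cnj u))) field_differentiable (at u)" if "u \<in> ?T" for u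
  proof -
    let ?h = "\<lambda>w. f (c - w)"
    have "?h field_differentiable (at (cnj u))"
    proof -
      have "f field_differentiable (at (c - cnj u))"
        using assms that holomorphic_on_imp_differentiable_at by blast
      then show ?thesis
        using field_differentiable_compose[of "\<lambda>w. c - w" "cnj u" f]
        by (simp add: o_def field_differentiable_diff field_differentiable_const field_differentiable_ident)
    qed
    then obtain D where "(?h has_field_derivative D) (at (cnj u))"
      unfolding field_differentiable_def by blast
    then have "((cnj \<circ> ?h \<circ> cnj) has_field_derivative cnj D) (at u)"
      by (rule has_field_derivative_cnj_cnj)
    then show ?thesis by (auto simp: field_differentiable_def o_def)
  qed
  then show ?thesis
    by (simp add: holomorphic_on_open[OF op] field_differentiable_def)
qed

text \<open>Polarisation: with \<open>c\<close> the midpoint of two real parameters \<open>x, y\<close>, the function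
  \<open>u \<mapsto> \<langle>a'(c + u), a'(c - cnj u)\<rangle> - \<langle>b'(c + u), b'(c - cnj u)\<rangle>\<close> is holomorphic and vanishes on the
  imaginary axis by the equality of speeds, so it also vanishes at \<open>u = (x - y) / 2\<close>.\<close>

lemma holomorphic_curve_chord_eq:
  fixes a b :: "complex \<Rightarrow> complex^'n"
  assumes S: "open S" "convex S" "0 \<in> S" "1 \<in> S"
    and a: "\<And>s. s \<in> S \<Longrightarrow> (a has_derivative (\<lambda>\<zeta>. \<zeta> *s a' s)) (at s)"
    and b: "\<And>s. s \<in> S \<Longrightarrow> (b has_derivative (\<lambda>\<zeta>. \<zeta> *s b' s)) (at s)"
    and speed: "\<And>s. s \<in> S \<Longrightarrow> norm (a' s) = norm (b' s)"
  shows "norm (a 1 - a 0) = norm (b 1 - b 0)"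
proof -
  have comp: "((\<lambda>s. c s $ i) has_field_derivative c' s $ i) (at s)"
    if "\<And>s. s \<in> S \<Longrightarrow> (c has_derivative (\<lambda>\<zeta>. \<zeta> *s c' s)) (at s)" "s \<in> S"
    for c c' :: "complex \<Rightarrow> complex^'n" and i s
  proof -
    have "((\<lambda>s. c s $ i) has_derivative (\<lambda>\<zeta>. (\<zeta> *s c' s) $ i)) (at s)"
      using bounded_linear.has_derivative[OF bounded_linear_vec_nth that(1)[OF that(2)]] .
    then show ?thesis by (simp add: has_field_derivative_def mult_commute_abs)
  qed
  have hol: "(\<lambda>s. c' s $ i) holomorphic_on S"
    if "\<And>s. s \<in> S \<Longrightarrow> (c has_derivative (\<lambda>\<zeta>. \<zeta> *s c' s)) (at s)" for c c' :: "complex \<Rightarrow> complex^'n" and i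
  proof -
    have "(\<lambda>s. c s $ i) holomorphic_on S"
      using comp[OF that] S(1) holomorphic_on_open by blast
    then have "deriv (\<lambda>s. c s $ i) holomorphic_on S"
      using S(1) holomorphic_deriv by blast
    then show ?thesis
      by (rule holomorphic_transform) (use comp[OF that] DERIV_imp_deriv in blast)
  qed
  note hola = hol[OF a] and holb = hol[OF b]
  have ipS: "a' (of_real x) \<bullet> a' (of_real y) = b' (of_real x) \<bullet> b' (of_real y)"
    if "of_real x \<in> S" "of_real y \<in> S" for x y :: real
  proof -
    define c where "c = (of_real ((x + y) / 2) :: complex)"
    define w where "w = (of_real ((x - y) / 2) :: complex)"
    define T where "T = {u. c + u \<in> S} \<inter> {u. c - cnj u \<in> S}"
    define g where "g u = (\<Sum>i\<in>UNIV. a' (c + u) $ i * cnj (a' (c - cnj u) $ i))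
                        - (\<Sum>i\<in>UNIV. b' (c + u) $ i * cnj (b' (c - cnj u) $ i))" for u
    have cS: "c \<in> S"
    proof -
      have "c = (1/2) *\<^sub>R of_real x + (1/2) *\<^sub>R of_real y" by (simp add: c_def scaleR_conv_of_real field_simps)
      then show ?thesis using convexD[OF S(2) that, of "1/2" "1/2"] by simp
    qed
    \<comment> \<open>Convexity of \<open>S\<close> passes to \<open>T\<close>, since both argument
      maps are real affine; this supplies the connectedness that the identity theorem asks
      for.\<close>
    have T: "open T" "convex T"
    proof -
      have "continuous_on UNIV (\<lambda>u. c + u)" "continuous_on UNIV (\<lambda>u. c - cnj u)"
        by (intro continuous_intros)+
      then have "open {u. c + u \<in> S}" "open {u. c - cnj u \<in> S}"
        using continuous_open_preimage[of UNIV "\<lambda>u. c + u" S] continuous_open_preimage[of UNIV "\<lambda>u. c - cnj u" S] S(1)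
        by (simp_all add: vimage_def)
      then show "open T" unfolding T_def by blast
      have lc: "linear cnj" by (simp add: linear_iff scaleR_conv_of_real)
      have "{u. c + u \<in> S} = (\<lambda>u. u - c) ` S" by (force simp: image_iff)
      moreover have "convex ((\<lambda>u. u - c) ` S)" using S(2) convex_translation_subtract by blast
      moreover have "{u. c - cnj u \<in> S} = cnj -` ((\<lambda>u. c - u) ` S)" by (force simp: image_iff)
      moreover have "convex ((\<lambda>u. c - u) ` S)"
      proof -
        have "(\<lambda>u. c - u) ` S = (\<lambda>u. c + u) ` (uminus ` S)" by (auto simp: image_image)
        then show ?thesis using convex_negations[OF S(2)] convex_translation by metis
      qed
      moreover have "convex (cnj -` X)" if "convex X" for X
        using convex_linear_vimage[OF lc that] .
      ultimately show "convex T" unfolding T_def by (metis convex_Int)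
    qed
    have sh: "(\<lambda>u. h (c + u)) holomorphic_on T" if "h holomorphic_on S" for h
    proof -
      have "(\<lambda>u. c + u) holomorphic_on T" "(\<lambda>u. c + u) ` T \<subseteq> S"
        by (auto simp: T_def intro!: holomorphic_intros)
      then show ?thesis
        using holomorphic_on_compose_gen[OF _ that, of "\<lambda>u. c + u" T] by (simp add: o_def)
    qed
    have rh: "(\<lambda>u. cnj (h (c - cnj u))) holomorphic_on T" if "h holomorphic_on S" for h
      using reflected_holomorphic[OF that S(1), of c] by (rule holomorphic_on_subset) (auto simp: T_def)
    have gh: "g holomorphic_on T"
      unfolding g_def
      by (intro holomorphic_on_diff holomorphic_on_sum holomorphic_on_mult
            sh[OF hola] sh[OF holb] rh[OF hola] rh[OF holb])
    have hn: "(\<Sum>i\<in>UNIV. v $ i * cnj (v $ i)) = of_real ((norm v)\<^sup>2)" for v :: "complex^'n"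
      by (simp add: complex_norm_square[symmetric] norm_vec_def L2_set_def sum_nonneg)
    have im0: "g u = 0" if "u \<in> T" "Re u = 0" for u
    proof -
      have "c - cnj u = c + u" using that(2) by (simp add: complex_eq_iff)
      moreover have "c + u \<in> S" using that by (simp add: T_def)
      ultimately show ?thesis unfolding g_def using speed by (simp only: hn) simp
    qed
    have T0: "0 \<in> T" using cS by (simp add: T_def)
    have lim: "0 islimpt {u \<in> T. Re u = 0}"
      unfolding islimpt_approachable
    proof (intro allI impI)
      fix e :: real assume "e > 0"
      obtain d where d: "d > 0" "ball 0 d \<subseteq> T" using T(1) T0 open_contains_ball by blast
      let ?u = "\<i> * of_real (min d e / 2)"
      have n: "norm ?u = min d e / 2" using d \<open>e > 0\<close> by (simp add: norm_mult)
      have "min d e / 2 < d" using d(1) by (simp add: min_def)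
      then have "?u \<in> T" using n by (intro subsetD[OF d(2)]) (simp only: mem_ball_0)
      moreover have "?u \<noteq> 0" "dist ?u 0 < e" using d n \<open>e > 0\<close> by (auto simp: dist_norm)
      ultimately show "\<exists>x'\<in>{u \<in> T. Re u = 0}. x' \<noteq> 0 \<and> dist x' 0 < e"
        by (intro bexI[of _ ?u]) auto
    qed
    have cw: "c + w = of_real x" "c - cnj w = of_real y"
      by (simp_all add: c_def w_def complex_eq_iff field_simps)
    have "w \<in> T" using cw that by (simp add: T_def)
    have "g w = 0"
      by (rule analytic_continuation[OF gh T(1) convex_connected[OF T(2)] _ T0 lim _ \<open>w \<in> T\<close>]) (use im0 in auto)
    then show ?thesis by (simp add: g_def cw cvec_inner)
  qed
  have real_in: "of_real x \<in> S" if "x \<in> {0..1}" for x :: real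
    using convexD[OF S(2,3,4), of "1 - x" x] that by (simp add: scaleR_conv_of_real)
  have rd: "((\<lambda>x. c (of_real x)) has_vector_derivative c' (of_real x)) (at x within {0..1})"
    if "\<And>s. s \<in> S \<Longrightarrow> (c has_derivative (\<lambda>\<zeta>. \<zeta> *s c' s)) (at s)" "x \<in> {0..1}"
    for c c' :: "complex \<Rightarrow> complex^'n" and x :: real
  proof -
    have 1: "((of_real :: real \<Rightarrow> complex) has_derivative of_real) (at x within {0..1})"
      using bounded_linear_imp_has_derivative[OF bounded_linear_of_real] .
    have "of_real h *s v = h *\<^sub>R v" for h :: real and v :: "complex^'n"
      by (simp add: vec_eq_iff scaleR_conv_of_real[where 'a=complex])
    then show ?thesis
      using has_derivative_compose[OF 1 that(1)[OF real_in[OF that(2)]]]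
      by (simp add: has_vector_derivative_def)
  qed
  show ?thesis
    using real_curve_chord_eq[OF rd[OF a] rd[OF b] ipS[OF real_in real_in]] by simp
qed

section \<open>Submanifolds as graphs over their tangent spaces\<close>

lemma orthogonal_projection_exists:
  fixes T :: "'a::euclidean_space set"
  assumes "subspace T"
  obtains P where "linear P" "\<And>x. P x \<in> T" "\<And>x. x \<in> T \<Longrightarrow> P x = x" "\<And>x t. t \<in> T \<Longrightarrow> (x - P x) \<bullet> t = 0"
proof -
  obtain B where B: "B \<subseteq> T" "pairwise orthogonal B" "\<And>x. x \<in> B \<Longrightarrow> norm x = 1"
    "independent B" "card B = dim T" "span B = T"
    using orthonormal_basis_subspace[OF assms] by blast
  have fin: "finite B" using B(4) independent_imp_finite by blast
  define P where "P x = (\<Sum>b\<in>B. (x \<bullet> b) *\<^sub>R b)" for x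
  have lin: "linear P"
    unfolding P_def by (auto simp: linear_iff inner_add_left scaleR_add_left sum.distrib scaleR_sum_right)
  have PT: "P x \<in> T" for x
    unfolding P_def using B(1) assms by (intro subspace_sum) (auto intro: subspace_scale)
  have orth: "(x - P x) \<bullet> b = 0" if "b \<in> B" for x b
  proof -
    have "P x \<bullet> b = (\<Sum>c\<in>B. (x \<bullet> c) * (c \<bullet> b))" by (simp add: P_def inner_sum_left)
    also have "\<dots> = (\<Sum>c\<in>B. if c = b then x \<bullet> b else 0)"
      using B(2,3) that by (intro sum.cong) (auto simp: pairwise_def orthogonal_def norm_eq_1)
    also have "\<dots> = x \<bullet> b" using fin that by simp
    finally show ?thesis by (simp add: inner_diff_left)
  qed
  have orthT: "(x - P x) \<bullet> t = 0" if "t \<in> T" for x t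
  proof -
    have "t \<in> span B" using that B(6) by simp
    then have "orthogonal (x - P x) t"
      by (rule orthogonal_to_span) (use orth in \<open>auto simp: orthogonal_def\<close>)
    then show ?thesis by (simp add: orthogonal_def)
  qed
  have "P x = x" if "x \<in> T" for x
  proof -
    have "x - P x \<in> T" using that PT assms by (simp add: subspace_diff)
    then have "(x - P x) \<bullet> (x - P x) = 0" by (rule orthT)
    then show ?thesis by simp
  qed
  then show thesis using that lin PT orthT by blast
qed

lemma has_vector_derivative_chain_at:
  assumes "(c has_vector_derivative v) (at s)" "(f has_derivative f') (at (c s))"
  shows "((\<lambda>s. f (c s)) has_vector_derivative f' v) (at s)"
  using has_derivative_compose[OF assms(1)[unfolded has_vector_derivative_def] assms(2)]
    linear_simps(5)[OF has_derivative_bounded_linear[OF assms(2)]]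
  by (simp add: has_vector_derivative_def)

text \<open>The component of the curve orthogonal to \<open>L\<close> vanishes near the parameter 0,
  and so does its derivative.\<close>

lemma derivative_in_subspace:
  fixes c :: "real \<Rightarrow> 'a::euclidean_space"
  assumes c: "(c has_vector_derivative v) (at 0)" and L: "subspace L" and "c 0 \<in> L" "\<forall>\<^sub>F s in at 0. c s \<in> L"
  shows "v \<in> L"
proof -
  obtain P where P: "linear P" "\<And>x. P x \<in> L" "\<And>x. x \<in> L \<Longrightarrow> P x = x"
    using orthogonal_projection_exists[OF L] by metis
  have bl: "bounded_linear (\<lambda>x. x - P x)"
    using bounded_linear_sub[OF bounded_linear_ident] P(1) linear_conv_bounded_linear by blast
  have "((\<lambda>s. c s - P (c s)) has_vector_derivative v - P v) (at 0)"
    using has_vector_derivative_chain_at[OF c bounded_linear_imp_has_derivative[OF bl]] .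
  moreover have "((\<lambda>s. c s - P (c s)) has_vector_derivative 0) (at 0)"
    unfolding has_vector_derivative_def
  proof (rule has_derivative_transform_eventually)
    show "((\<lambda>s. 0) has_derivative (\<lambda>h. h *\<^sub>R 0)) (at 0)" by simp
    show "\<forall>\<^sub>F s in at 0. 0 = c s - P (c s)"
      using assms(4) by eventually_elim (use P(3) in simp)
  qed (use P(3) assms(3) in auto)
  ultimately have "v - P v = 0" by (rule vector_derivative_unique_at)
  then show ?thesis using P(2)[of v] by simp
qed

locale submanifold_chart =
  fixes M U V :: "'a::euclidean_space set" and \<phi> \<psi> :: "'a \<Rightarrow> 'a" and L :: "'a set"
  assumes smooth_phi: "smooth_on U \<phi>" and smooth_psi: "smooth_on V \<psi>"
    and image: "\<phi> ` U = V"
    and psi_phi: "\<And>x. x \<in> U \<Longrightarrow> \<psi> (\<phi> x) = x"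
    and phi_psi: "\<And>y. y \<in> V \<Longrightarrow> \<phi> (\<psi> y) = y"
    and subspace_L: "subspace L"
    and image_M: "\<phi> ` (M \<inter> U) = V \<inter> L"
begin

abbreviation "D\<phi> x \<equiv> frechet_derivative \<phi> (at x)"
abbreviation "D\<psi> y \<equiv> frechet_derivative \<psi> (at y)"

lemma open_U: "open U" and open_V: "open V"
  using smooth_phi smooth_psi by (auto simp: smooth_on_def)

lemma phi_in_V: "x \<in> U \<Longrightarrow> \<phi> x \<in> V"
  using image by blast

lemma mem_M_iff: "x \<in> U \<Longrightarrow> x \<in> M \<longleftrightarrow> \<phi> x \<in> L"
  using image_M phi_in_V psi_phi by (metis (no_types, lifting) IntD1 IntD2 IntI imageE image_eqI)

lemma psi_in_M: "y \<in> V \<Longrightarrow> y \<in> L \<Longrightarrow> \<psi> y \<in> M"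
  using image_M psi_phi by (metis (no_types, lifting) IntD1 IntD2 IntI imageE)

lemma psi_in_U: "y \<in> V \<Longrightarrow> \<psi> y \<in> U"
  using image psi_phi by force

lemma phi_deriv: "x \<in> U \<Longrightarrow> (\<phi> has_derivative D\<phi> x) (at x)"
  using smooth_on_has_derivative smooth_phi by blast

lemma psi_deriv: "y \<in> V \<Longrightarrow> (\<psi> has_derivative D\<psi> y) (at y)"
  using smooth_on_has_derivative smooth_psi by blast

lemma Dpsi_Dphi:
  assumes "x \<in> U" shows "D\<psi> (\<phi> x) (D\<phi> x v) = v"
proof -
  have "((\<lambda>x. \<psi> (\<phi> x)) has_derivative (\<lambda>v. D\<psi> (\<phi> x) (D\<phi> x v))) (at x)"
    using has_derivative_compose[OF phi_deriv[OF assms] psi_deriv[OF phi_in_V[OF assms]]] .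
  moreover have "((\<lambda>x. \<psi> (\<phi> x)) has_derivative (\<lambda>v. v)) (at x)"
    using has_derivative_transform_within_open[OF has_derivative_ident open_U assms] psi_phi by metis
  ultimately show ?thesis using has_derivative_unique fun_cong[where x=v] by blast
qed

lemma Dphi_Dpsi:
  assumes "y \<in> V" shows "D\<phi> (\<psi> y) (D\<psi> y v) = v"
proof -
  have "((\<lambda>x. \<phi> (\<psi> x)) has_derivative (\<lambda>v. D\<phi> (\<psi> y) (D\<psi> y v))) (at y)"
    using has_derivative_compose[OF psi_deriv[OF assms] phi_deriv[OF psi_in_U[OF assms]]] .
  moreover have "((\<lambda>x. \<phi> (\<psi> x)) has_derivative (\<lambda>v. v)) (at y)"
    using has_derivative_transform_within_open[OF has_derivative_ident open_V assms] phi_psi by metis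
  ultimately show ?thesis using has_derivative_unique fun_cong[where x=v] by blast
qed

lemma curve_derivative_in_image:
  assumes x: "x \<in> M \<inter> U" and c: "(c has_vector_derivative v) (at 0)" "c 0 = x" "\<forall>\<^sub>F s in at 0. c s \<in> M"
  shows "v \<in> D\<psi> (\<phi> x) ` L"
proof -
  have "isCont c 0" using c(1) has_vector_derivative_continuous by blast
  then have "\<forall>\<^sub>F s in at 0. c s \<in> U"
    using open_U x c(2) unfolding isCont_def by (metis IntD2 topological_tendstoD)
  with c(3) have ev: "\<forall>\<^sub>F s in at 0. \<phi> (c s) \<in> L"
    by eventually_elim (use mem_M_iff in blast)
  have "((\<lambda>s. \<phi> (c s)) has_vector_derivative D\<phi> x v) (at 0)"
    using has_vector_derivative_chain_at[OF c(1), of \<phi> "D\<phi> x"] phi_deriv[of x] x c(2) by simp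
  then have "D\<phi> x v \<in> L"
    by (rule derivative_in_subspace) (use subspace_L ev mem_M_iff x c(2) in auto)
  then show ?thesis using Dpsi_Dphi x by (metis IntD2 image_eqI)
qed

lemma tangent_space_eq:
  assumes x: "x \<in> M \<inter> U"
  shows "tangent_space M x = D\<psi> (\<phi> x) ` L"
proof
  show "tangent_space M x \<subseteq> D\<psi> (\<phi> x) ` L"
  proof
    fix v assume "v \<in> tangent_space M x"
    then obtain c e where c: "0 < e" "c 0 = x" "\<forall>t\<in>{-e<..<e}. c t \<in> M" "(c has_vector_derivative v) (at 0)"
      unfolding tangent_space_def by blast
    have "\<forall>\<^sub>F s in at 0. s \<in> {-e<..<e}"
      by (rule eventually_at_in_open') (use c in auto)
    then have "\<forall>\<^sub>F s in at 0. c s \<in> M" by eventually_elim (use c in blast)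
    then show "v \<in> D\<psi> (\<phi> x) ` L" using curve_derivative_in_image x c by blast
  qed
  show "D\<psi> (\<phi> x) ` L \<subseteq> tangent_space M x"
  proof
    fix v assume "v \<in> D\<psi> (\<phi> x) ` L"
    then obtain l where l: "l \<in> L" "v = D\<psi> (\<phi> x) l" by blast
    have yV: "\<phi> x \<in> V" and yL: "\<phi> x \<in> L" using x image_M by auto
    have "open {s::real. \<phi> x + s *\<^sub>R l \<in> V}"
    proof -
      have "continuous_on UNIV (\<lambda>s::real. \<phi> x + s *\<^sub>R l)" by (intro continuous_intros)
      then show ?thesis using continuous_open_preimage[of UNIV _ V] open_V by (simp add: vimage_def)
    qed
    then obtain e where e: "e > 0" "ball 0 e \<subseteq> {s::real. \<phi> x + s *\<^sub>R l \<in> V}"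
      using yV unfolding open_contains_ball by (metis (mono_tags, lifting) add.right_neutral mem_Collect_eq scale_zero_left)
    then have inV: "\<phi> x + s *\<^sub>R l \<in> V" if "s \<in> {-e<..<e}" for s
      using that by (auto simp: subset_iff)
    have 1: "smooth_on {-e<..<e} (\<lambda>s. \<psi> (\<phi> x + s *\<^sub>R l))"
      unfolding smooth_on_def
      using smooth_k_compose_affine[of "{-e<..<e}" "\<lambda>s. s *\<^sub>R l" "\<phi> x" V _ \<psi>] inV smooth_psi
      by (auto simp: bounded_linear_scaleR_left smooth_on_def)
    have 2: "((\<lambda>s. \<psi> (\<phi> x + s *\<^sub>R l)) has_vector_derivative v) (at 0)"
      unfolding l(2) by (rule has_vector_derivative_chain_at)
        (use psi_deriv[OF yV] in \<open>auto intro!: derivative_eq_intros\<close>)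
    have 3: "\<psi> (\<phi> x + s *\<^sub>R l) \<in> M" if "s \<in> {-e<..<e}" for s
      using psi_in_M inV[OF that] yL l(1) subspace_L by (simp add: subspace_add subspace_scale)
    show "v \<in> tangent_space M x"
      unfolding tangent_space_def using 1 2 3 e(1) psi_phi x
      by (intro CollectI exI[of _ "\<lambda>s. \<psi> (\<phi> x + s *\<^sub>R l)"] exI[of _ e]) auto
  qed
qed

lemma linear_Dpsi: "y \<in> V \<Longrightarrow> linear (D\<psi> y)"
  using psi_deriv has_derivative_linear by blast

lemma inj_Dpsi: "y \<in> V \<Longrightarrow> inj (D\<psi> y)"
  by (metis Dphi_Dpsi injI)

lemma subspace_tangent: "x \<in> M \<inter> U \<Longrightarrow> subspace (tangent_space M x)"
  using tangent_space_eq linear_Dpsi[OF phi_in_V] subspace_L linear_subspace_image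
  by (metis IntD2)

lemma dim_tangent: "x \<in> M \<inter> U \<Longrightarrow> dim (tangent_space M x) = dim L"
  using tangent_space_eq linear_Dpsi phi_in_V inj_Dpsi dim_image_eq
  by (metis IntD2 inj_on_subset subset_UNIV)

end

lemma submanifold_chart_exists:
  assumes "submanifold d M" "p \<in> M"
  obtains U V \<phi> \<psi> L where "submanifold_chart M U V \<phi> \<psi> L" "p \<in> U" "dim L = d"
  using assms unfolding submanifold_def submanifold_chart_def by metis

lemma subspace_tangent_space:
  assumes "submanifold d M" "p \<in> M"
  shows "subspace (tangent_space M p)" and "dim (tangent_space M p) = d"
proof -
  obtain U V \<phi> \<psi> L where "submanifold_chart M U V \<phi> \<psi> L" "p \<in> U" "dim L = d"
    using submanifold_chart_exists[OF assms] .
  then interpret submanifold_chart M U V \<phi> \<psi> L by simp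
  show "subspace (tangent_space M p)" "dim (tangent_space M p) = d"
    using subspace_tangent dim_tangent assms(2) \<open>p \<in> U\<close> \<open>dim L = d\<close> by auto
qed

text \<open>\<open>tangent_space\<close> is defined by smooth curves, whereas here a derivative at 0
  is enough. This makes it applicable to curves in a graph chart, whose map comes from the inverse
  function theorem with first derivatives only.\<close>

lemma curve_derivative_in_tangent_space:
  assumes "submanifold d M" "p \<in> M"
    and "(c has_vector_derivative v) (at 0)" "c 0 = p" "\<forall>\<^sub>F s in at 0. c s \<in> M"
  shows "v \<in> tangent_space M p"
proof -
  obtain U V \<phi> \<psi> L where "submanifold_chart M U V \<phi> \<psi> L" "p \<in> U" "dim L = d"
    using submanifold_chart_exists[OF assms(1,2)] .
  then interpret submanifold_chart M U V \<phi> \<psi> L by simp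
  show ?thesis
    using curve_derivative_in_image[of p] tangent_space_eq assms \<open>p \<in> U\<close> by blast
qed

text \<open>With the chart \<open>\<phi>\<close>, its inverse \<open>\<psi>\<close> and the projection \<open>P\<close> onto the tangent space, the map
  \<open>x \<mapsto> P x + (1 - P) (\<psi>'(\<phi> p) (\<phi> x))\<close> has derivative \<open>1\<close> at \<open>p\<close> and turns \<open>M\<close> into its tangent space.\<close>

lemma graph_over_tangent_space:
  fixes M :: "'a::euclidean_space set"
  assumes sub: "submanifold d M" and p: "p \<in> M" and G: "open G" "p \<in> G"
    and P: "linear P" "\<And>x. P x \<in> tangent_space M p" "\<And>x. x \<in> tangent_space M p \<Longrightarrow> P x = x"
  obtains W r g g' where "open W" "p \<in> W" "W \<subseteq> G" "0 < r"
    "\<forall>y\<in>ball (P p) r. (g has_derivative g' y) (at y)"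
    "\<forall>y\<in>ball (P p) r \<inter> tangent_space M p. g y \<in> M \<inter> G \<and> P (g y) = y"
    "\<forall>q\<in>M \<inter> W. P q \<in> ball (P p) r \<and> g (P q) = q"
proof -
  obtain U V \<phi> \<psi> L where "submanifold_chart M U V \<phi> \<psi> L" "p \<in> U" "dim L = d"
    using submanifold_chart_exists[OF sub p] .
  then interpret submanifold_chart M U V \<phi> \<psi> L by simp
  let ?T = "tangent_space M p"
  let ?\<rho> = "D\<psi> (\<phi> p)"
  have pMU: "p \<in> M \<inter> U" using p \<open>p \<in> U\<close> by simp
  have T: "subspace ?T" "?T = ?\<rho> ` L" using subspace_tangent[OF pMU] tangent_space_eq[OF pMU] by auto
  have \<rho>: "linear ?\<rho>" "inj ?\<rho>" using linear_Dpsi inj_Dpsi phi_in_V \<open>p \<in> U\<close> by auto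
  have blP: "bounded_linear P" and bl\<rho>: "bounded_linear ?\<rho>"
    using P(1) \<rho>(1) linear_conv_bounded_linear by auto
  define Q where "Q x = x - P x" for x
  have blQ: "bounded_linear Q"
    unfolding Q_def using bounded_linear_sub[OF bounded_linear_ident blP] .
  have PP: "P (P x) = P x" for x using P by blast
  have QT: "Q x = 0 \<longleftrightarrow> x \<in> ?T" for x using P(2,3) by (metis Q_def eq_iff_diff_eq_0)
  have PQ: "P (Q x) = 0" for x using linear_diff[OF P(1)] PP by (simp add: Q_def)
  define f where "f x = P x + Q (?\<rho> (\<phi> x))" for x
  define f' where "f' x = Blinfun (\<lambda>v. P v + Q (?\<rho> (D\<phi> x v)))" for x
  have blD: "bounded_linear (D\<phi> x)" if "x \<in> U" for x
    using phi_deriv[OF that] has_derivative_bounded_linear by blast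
  have f'_apply: "blinfun_apply (f' x) = (\<lambda>v. P v + Q (?\<rho> (D\<phi> x v)))" if "x \<in> U" for x
    unfolding f'_def
    by (intro bounded_linear_Blinfun_apply bounded_linear_add blP bounded_linear_compose[OF blQ]
          bounded_linear_compose[OF bl\<rho>] blD[OF that])
  have f_deriv: "(f has_derivative blinfun_apply (f' x)) (at x)" if "x \<in> U \<inter> G" for x
  proof -
    have xU: "x \<in> U" using that by simp
    show ?thesis
      unfolding f_def f'_apply[OF xU]
      by (intro has_derivative_add bounded_linear_imp_has_derivative blP
          bounded_linear.has_derivative[OF blQ] bounded_linear.has_derivative[OF bl\<rho>] phi_deriv[OF xU])
  qed
  have f'_cont: "continuous_on (U \<inter> G) f'"
  proof (rule continuous_on_blinfun_componentwise)
    fix i :: 'a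
    have "continuous_on (U \<inter> G) (\<lambda>x. P i + Q (?\<rho> (D\<phi> x i)))"
      by (intro continuous_intros bounded_linear.continuous_on[OF blQ] bounded_linear.continuous_on[OF bl\<rho>]
          continuous_on_subset[OF smooth_on_deriv_continuous[OF smooth_phi]]) auto
    then show "continuous_on (U \<inter> G) (\<lambda>x. blinfun_apply (f' x) i)"
      by (rule continuous_on_eq) (simp add: f'_apply)
  qed
  have id: "id_blinfun o\<^sub>L f' p = id_blinfun"
    by (rule blinfun_eqI) (simp add: f'_apply[OF \<open>p \<in> U\<close>] Dpsi_Dphi[OF \<open>p \<in> U\<close>] Q_def)
  have fM: "x \<in> M \<longleftrightarrow> f x \<in> ?T" if "x \<in> U" for x
  proof -
    have "x \<in> M \<longleftrightarrow> ?\<rho> (\<phi> x) \<in> ?T"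
      using mem_M_iff[OF that] T(2) \<rho>(2) by (simp add: inj_image_mem_iff)
    also have "\<dots> \<longleftrightarrow> Q (?\<rho> (\<phi> x)) = 0" using QT by simp
    also have "\<dots> \<longleftrightarrow> Q (f x) = 0"
      unfolding f_def Q_def using P(1) PP by (simp add: linear_add linear_diff)
    finally show ?thesis using QT by simp
  qed
  have Pf: "P (f x) = P x" for x
    using P(1) PP PQ by (simp add: f_def linear_add)
  obtain U' V' g g' where inv: "open U'" "U' \<subseteq> U \<inter> G" "p \<in> U'" "open V'" "f p \<in> V'" "homeomorphism U' V' f g"
    "\<And>y. y \<in> V' \<Longrightarrow> (g has_derivative (g' y)) (at y)"
    using inverse_function_theorem[OF open_Int[OF open_U G(1)] f_deriv f'_cont _ id] G(2) \<open>p \<in> U\<close>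
    by (metis IntI)
  have fp: "f p = P p" using fM[OF \<open>p \<in> U\<close>] p P(3) Pf by metis
  obtain r where r: "r > 0" "ball (P p) r \<subseteq> V'"
    using inv(4,5) fp open_contains_ball by metis
  \<comment> \<open>Restricting to the preimage of a ball makes the domain of the graph map convex;
    later the complex line through two projected points is cut down to this ball, giving a convex
    parameter set.\<close>
  define W where "W = U' \<inter> f -` ball (P p) r"
  have W: "open W"
    unfolding W_def using homeomorphism_cont1[OF inv(6)] inv(1)
    by (intro continuous_open_preimage) auto
  show thesis
  proof (rule that[of W r g g'])
    show "open W" "0 < r" by fact+
    show "p \<in> W" using inv(3) r(1) fp by (simp add: W_def)
    show "W \<subseteq> G" using inv(2) by (auto simp: W_def)
    show "\<forall>y\<in>ball (P p) r. (g has_derivative g' y) (at y)"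
      using inv(7) r(2) by blast
    show "\<forall>y\<in>ball (P p) r \<inter> ?T. g y \<in> M \<inter> G \<and> P (g y) = y"
    proof
      fix y assume that: "y \<in> ball (P p) r \<inter> ?T"
      have y: "y \<in> V'" using that r by blast
      have 1: "g y \<in> U'" "f (g y) = y" using inv(6) y by (auto simp: homeomorphism_def)
      then have "g y \<in> M" using fM[of "g y"] inv(2) that by auto
      moreover have "P (g y) = y" using Pf[of "g y"] 1 P(3) that by simp
      ultimately show "g y \<in> M \<inter> G \<and> P (g y) = y" using 1 inv(2) by blast
    qed
    show "\<forall>q\<in>M \<inter> W. P q \<in> ball (P p) r \<and> g (P q) = q"
    proof
      fix q assume that: "q \<in> M \<inter> W"
      have q: "q \<in> U'" "f q \<in> ball (P p) r" using that by (auto simp: W_def)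
      have "f q = P q" using fM[of q] q inv(2) that P(3) Pf by (metis IntD1 subsetD)
      then show "P q \<in> ball (P p) r \<and> g (P q) = q" using q inv(6) by (auto simp: homeomorphism_def)
    qed
  qed
qed

section \<open>Vertical pseudohermitian submanifolds\<close>

text \<open>Multiplication by \<open>\<i>\<close> as a real linear isometry: it turns
  \<open>Theta\<close>, \<open>dTheta\<close> and \<open>levi\<close> into expressions in the real
  inner product.\<close>

definition cJ :: "complex^'n::finite \<Rightarrow> complex^'n" where
  "cJ x = \<i> *s x"

lemma linear_cJ: "linear cJ"
  by (simp add: linear_iff cJ_def vec_eq_iff algebra_simps)

lemma bounded_linear_cJ: "bounded_linear cJ"
  using linear_cJ linear_conv_bounded_linear by blast

lemma cJ_inner_cJ [simp]: "cJ x \<bullet> cJ y = x \<bullet> y"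
  by (simp add: cJ_def inner_vec_def inner_complex_def add.commute)

lemma cJ_inner: "cJ x \<bullet> y = - (x \<bullet> cJ y)"
  by (simp add: cJ_def inner_vec_def inner_complex_def sum_negf[symmetric])

lemma norm_cJ [simp]: "norm (cJ x) = norm x"
  by (simp add: norm_eq_sqrt_inner)

lemma complex_scale_cJ: "s *s x = Re s *\<^sub>R x + Im s *\<^sub>R cJ x"
  by (simp add: cJ_def vec_eq_iff complex_eq_iff)

lemma Theta_cJ: "Theta p v = snd v + cJ (fst p) \<bullet> fst v"
  unfolding Theta_def by (simp add: cJ_def inner_vec_def inner_complex_def algebra_simps)

lemma Jst_cJ: "Jst p v = (cJ (fst v), - (fst p \<bullet> fst v))"
  unfolding Jst_def by (simp add: cJ_def inner_vec_def inner_complex_def vec_eq_iff)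

lemma dTheta_cJ: "dTheta v w = 2 * (cJ (fst v) \<bullet> fst w)"
  unfolding dTheta_def by (simp add: cJ_def inner_vec_def inner_complex_def)

lemma levi_inner: "levi p v w = 2 * (fst v \<bullet> fst w)"
  by (simp add: levi_def dTheta_cJ Jst_cJ)

lemma fst_ps_nabla: "fst (ps_nabla p X Y) = fst (frechet_derivative X (at p) Y)"
  by (simp add: ps_nabla_def hlift_def Reeb_def)

locale vertical_ph_submanifold =
  fixes M :: "'n::finite heis set" and m :: nat
  assumes ph: "ph_submanifold m M" and vert: "vertical M"
begin

lemma submanifold_M: "submanifold (2 * m + 1) M"
  using ph by (simp add: ph_submanifold_def)

abbreviation "T q \<equiv> tangent_space M q"

lemma subspace_T: "q \<in> M \<Longrightarrow> subspace (T q)"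
  using subspace_tangent_space(1)[OF submanifold_M] .

lemma dim_T: "q \<in> M \<Longrightarrow> dim (T q) = 2 * m + 1"
  using subspace_tangent_space(2)[OF submanifold_M] .

lemma Reeb_T: "q \<in> M \<Longrightarrow> Reeb \<in> T q"
  using vert by (simp add: vertical_def)

text \<open>Adding multiples of \<open>Reeb\<close> changes the \<open>t\<close>-component at will,
  so a vertical tangent space is the full preimage of its projection to \<open>C^n\<close>.\<close>

lemma T_vertical:
  assumes "q \<in> M" "v \<in> T q" "fst w = fst v"
  shows "w \<in> T q"
proof -
  have "w = v + (snd w - snd v) *\<^sub>R Reeb"
    using assms(3) by (simp add: Reeb_def prod_eq_iff)
  then show ?thesis
    using subspace_T[OF assms(1)] assms(2) Reeb_T[OF assms(1)] by (metis subspace_add subspace_scale)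
qed

lemma horizontal_part:
  assumes "q \<in> M" "v \<in> T q"
  shows "v - Theta q v *\<^sub>R Reeb \<in> xi_hat M q"
proof -
  have "v - Theta q v *\<^sub>R Reeb \<in> T q"
    by (rule T_vertical[OF assms]) (simp add: Reeb_def)
  then show ?thesis by (simp add: xi_hat_def xi_def Theta_cJ Reeb_def)
qed

text \<open>\<open>Jst\<close> is available only on horizontal vectors. The Reeb part is removed
  first, and the \<open>t\<close>-component produced by \<open>Jst\<close> is irrelevant by
  verticality.\<close>

lemma T_cJ:
  assumes "q \<in> M" "v \<in> T q" "fst w = cJ (fst v)"
  shows "w \<in> T q"
proof -
  have "Jst q (v - Theta q v *\<^sub>R Reeb) \<in> xi_hat M q"
    using ph assms(1) horizontal_part[OF assms(1,2)] unfolding ph_submanifold_def by blast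
  then have "Jst q (v - Theta q v *\<^sub>R Reeb) \<in> T q" by (simp add: xi_hat_def)
  then show ?thesis
    by (rule T_vertical[OF assms(1)]) (simp add: Jst_cJ Reeb_def assms(3))
qed

lemma T_complex_scale:
  assumes "q \<in> M" "v \<in> T q" "fst w = s *s fst v"
  shows "w \<in> T q"
proof -
  have "(cJ (fst v), 0) \<in> T q" by (rule T_cJ[OF assms(1,2)]) simp
  then have "Re s *\<^sub>R v + Im s *\<^sub>R (cJ (fst v), 0) \<in> T q"
    using subspace_T[OF assms(1)] assms(2) by (meson subspace_add subspace_scale)
  then show ?thesis
    by (rule T_vertical[OF assms(1)]) (simp add: assms(3) complex_scale_cJ)
qed

lemma fst_xi_hat:
  assumes "q \<in> M"
  shows "fst ` xi_hat M q = fst ` T q"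
proof
  show "fst ` xi_hat M q \<subseteq> fst ` T q" by (auto simp: xi_hat_def)
  show "fst ` T q \<subseteq> fst ` xi_hat M q"
  proof
    fix e assume "e \<in> fst ` T q"
    then obtain v where "v \<in> T q" "e = fst v" by blast
    then have "v - Theta q v *\<^sub>R Reeb \<in> xi_hat M q" "e = fst (v - Theta q v *\<^sub>R Reeb)"
      using horizontal_part[OF assms] by (auto simp: Reeb_def)
    then show "e \<in> fst ` xi_hat M q" by blast
  qed
qed

lemma subspace_xi_hat: "q \<in> M \<Longrightarrow> subspace (xi_hat M q)"
proof -
  assume "q \<in> M"
  have "subspace (xi q)"
    by (rule subspaceI) (auto simp: xi_def Theta_cJ inner_add_right distrib_left[symmetric])
  then show ?thesis
    using subspace_T[OF \<open>q \<in> M\<close>] by (simp add: xi_hat_def subspace_inter)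
qed

text \<open>On \<open>xi_hat\<close> the equation \<open>Theta = 0\<close> recovers the
  \<open>t\<close>-component from the \<open>C^n\<close> part, so \<open>fst\<close> is injective
  there and keeps the dimension.\<close>

lemma dim_fst_T:
  assumes "q \<in> M"
  shows "subspace (fst ` T q)" "dim (fst ` T q) = 2 * m"
proof -
  show "subspace (fst ` T q)"
    using linear_subspace_image[OF linear_fst subspace_T[OF assms]] .
  have "inj_on fst (xi_hat M q)"
    by (rule inj_onI) (auto simp: xi_hat_def xi_def Theta_cJ prod_eq_iff)
  then have "dim (fst ` xi_hat M q) = dim (xi_hat M q)"
    using dim_image_eq[OF linear_fst] subspace_xi_hat[OF assms] by (metis span_eq_iff)
  then show "dim (fst ` T q) = 2 * m"
    using ph assms fst_xi_hat by (simp add: ph_submanifold_def)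
qed

text \<open>Only the \<open>C^n\<close> part of \<open>c\<close> is required to be holomorphic; its
  \<open>t\<close>-component is merely real differentiable. The end points lie in \<open>W\<close>,
  but the curve may wander through the larger set \<open>G\<close>, on which the data to be compared
  are available. The parameter set is open and convex for the sake of the identity theorem.\<close>

definition holomorphically_connected :: "'n heis set \<Rightarrow> 'n heis set \<Rightarrow> bool" where
  "holomorphically_connected W G \<longleftrightarrow> (\<forall>q1\<in>M \<inter> W. \<forall>q2\<in>M \<inter> W.
       \<exists>S c. open S \<and> convex S \<and> 0 \<in> S \<and> 1 \<in> S \<and> c 0 = q1 \<and> c (1::complex) = q2 \<and>
         (\<forall>s\<in>S. c s \<in> M \<inter> G \<and> (\<exists>D w. (c has_derivative D) (at s) \<and>
             (\<forall>\<zeta>. D \<zeta> \<in> T (c s) \<and> fst (D \<zeta>) = \<zeta> *s w))))"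

text \<open>In the graph chart \<open>g\<close> over \<open>T p\<close>, the derivative of \<open>g\<close> is complex linear modulo \<open>Reeb\<close>, because
  its values lie in \<open>T (g y)\<close>, on which the projection to \<open>T p\<close> is injective. Hence complex lines
  in \<open>T p\<close> give holomorphic curves in the projection of \<open>M\<close> to \<open>C^n\<close>.\<close>

lemma holomorphic_curves_in_submanifold:
  assumes p: "p \<in> M" and G: "open G" "p \<in> G"
  obtains W where "open W" "p \<in> W" "W \<subseteq> G"
    "holomorphically_connected W G"
proof -
  note Tp = subspace_T[OF p]
  obtain P where P: "linear P" "\<And>x. P x \<in> T p" "\<And>x. x \<in> T p \<Longrightarrow> P x = x"
     "\<And>x t. t \<in> T p \<Longrightarrow> (x - P x) \<bullet> t = 0"
    using orthogonal_projection_exists[OF Tp] by blast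
  obtain W r g g' where W: "open W" "p \<in> W" "W \<subseteq> G" "0 < r"
    and graph: "\<forall>y\<in>ball (P p) r. (g has_derivative g' y) (at y)"
      "\<forall>y\<in>ball (P p) r \<inter> T p. g y \<in> M \<inter> G \<and> P (g y) = y"
      "\<forall>q\<in>M \<inter> W. P q \<in> ball (P p) r \<and> g (P q) = q"
    by (rule graph_over_tangent_space[OF submanifold_M p G P(1-3)])
  have g_deriv: "\<And>y. y \<in> ball (P p) r \<Longrightarrow> (g has_derivative g' y) (at y)"
    and g_in: "\<And>y. y \<in> ball (P p) r \<Longrightarrow> y \<in> T p \<Longrightarrow> g y \<in> M \<inter> G \<and> P (g y) = y"
    and g_P: "\<And>q. q \<in> M \<inter> W \<Longrightarrow> P q \<in> ball (P p) r \<and> g (P q) = q"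
    using graph by blast+
  have P0: "P x = 0" if "\<And>t. t \<in> T p \<Longrightarrow> x \<bullet> t = 0" for x
  proof -
    have "P x \<bullet> P x = 0" using that[OF P(2)] P(4)[OF P(2), of x x] by (simp add: inner_diff_left)
    then show ?thesis by simp
  qed
  have slope: "g' y l \<in> T (g y) \<and> P (g' y l) = l" if y: "y \<in> ball (P p) r" "y \<in> T p" and l: "l \<in> T p" for y l
  proof -
    let ?c = "\<lambda>s::real. y + s *\<^sub>R l"
    have cd: "(?c has_vector_derivative l) (at 0)" by (auto intro!: derivative_eq_intros)
    then have gd: "((\<lambda>s. g (?c s)) has_vector_derivative g' y l) (at 0)"
      using has_vector_derivative_chain_at[OF cd, of g "g' y"] g_deriv[OF y(1)] by simp
    have "isCont ?c 0" by (intro continuous_intros)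
    then have ev: "\<forall>\<^sub>F s in at 0. ?c s \<in> ball (P p) r"
      using y(1) topological_tendstoD[of ?c y "at 0" "ball (P p) r"] by (simp add: isCont_def)
    have cT: "?c s \<in> T p" for s using y(2) l Tp by (simp add: subspace_add subspace_scale)
    have "g' y l \<in> T (g y)"
    proof (rule curve_derivative_in_tangent_space[OF submanifold_M _ gd])
      show "\<forall>\<^sub>F s in at 0. g (?c s) \<in> M" using ev by eventually_elim (use g_in cT in blast)
    qed (use g_in[OF y] in auto)
    moreover have "((\<lambda>s. P (g (?c s))) has_vector_derivative P (g' y l)) (at 0)"
      using has_vector_derivative_chain_at[OF gd, of P P] P(1)
      by (simp add: linear_conv_bounded_linear bounded_linear_imp_has_derivative)
    moreover have "((\<lambda>s. P (g (?c s))) has_vector_derivative l) (at 0)"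
      using cd unfolding has_vector_derivative_def
    proof (rule has_derivative_transform_eventually)
      show "\<forall>\<^sub>F s in at 0. ?c s = P (g (?c s))" using ev by eventually_elim (use g_in cT in simp)
    qed (use g_in[OF y] in auto)
    ultimately show ?thesis using vector_derivative_unique_at by blast
  qed
  \<comment> \<open>A dimension count: \<open>g' y\<close> embeds \<open>T p\<close> into
    \<open>T (g y)\<close>, and both have dimension \<open>2 * m + 1\<close>. Hence every vector of
    \<open>T (g y)\<close> is some \<open>g' y l\<close>, and \<open>P\<close> recovers
    \<open>l\<close> from it.\<close>
  have P_inj: "v = 0" if y: "y \<in> ball (P p) r" "y \<in> T p" and v: "v \<in> T (g y)" "P v = 0" for y v
  proof -
    have lin: "linear (g' y)" using g_deriv[OF y(1)] has_derivative_linear by blast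
    have "inj_on (g' y) (span (T p))"
      using slope[OF y] Tp by (metis inj_onI span_eq_iff)
    then have "dim (g' y ` T p) = 2 * m + 1" using dim_image_eq[OF lin] dim_T[OF p] by simp
    moreover have "subspace (g' y ` T p)" using linear_subspace_image[OF lin Tp] .
    moreover have "g y \<in> M" using g_in[OF y] by blast
    moreover have "g' y ` T p \<subseteq> T (g y)" using slope[OF y] by blast
    ultimately have "g' y ` T p = T (g y)"
      using subspace_dim_equal[of "g' y ` T p" "T (g y)"] dim_T subspace_T by simp
    then obtain l where "l \<in> T p" "v = g' y l" using v(1) by blast
    then show ?thesis using slope[OF y] v(2) lin linear_0 by metis
  qed
  have g'_Reeb: "g' y Reeb = Reeb" if y: "y \<in> ball (P p) r" "y \<in> T p" for y
  proof -
    have gM: "g y \<in> M" using g_in[OF y] by blast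
    have "g' y Reeb - Reeb \<in> T (g y)"
      using slope[OF y Reeb_T[OF p]] Reeb_T[OF gM] subspace_T[OF gM] by (simp add: subspace_diff)
    moreover have "P (g' y Reeb - Reeb) = 0"
      using slope[OF y Reeb_T[OF p]] P(1,3) Reeb_T[OF p] by (simp add: linear_diff)
    ultimately have "g' y Reeb - Reeb = 0" by (rule P_inj[OF y])
    then show ?thesis by simp
  qed
  have g'_cJ: "g' y (cJ z, 0) = (cJ (fst (g' y (z, 0))), 0)"
    if y: "y \<in> ball (P p) r" "y \<in> T p" and z: "(z, 0) \<in> T p" for y z
  proof -
    have gM: "g y \<in> M" using g_in[OF y] by blast
    have Jz: "(cJ z, 0) \<in> T p" by (rule T_cJ[OF p z]) simp
    \<comment> \<open>The part of \<open>g' y (z, 0)\<close> normal to \<open>T p\<close> remains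
      normal after multiplication by \<open>\<i>\<close>, because \<open>T p\<close> is invariant
      under it. So both sides of the claim are tangent at \<open>g y\<close> and have the same
      projection \<open>(cJ z, 0)\<close>; injectivity of \<open>P\<close> identifies them.\<close>
    define n where "n = g' y (z, 0) - (z, 0)"
    have n: "n \<bullet> t = 0" if "t \<in> T p" for t
      using P(4)[OF that, of "g' y (z, 0)"] slope[OF y z] by (simp add: n_def)
    have "(cJ (fst n), 0) \<bullet> t = 0" if "t \<in> T p" for t
    proof -
      have "(cJ (fst t), 0) \<in> T p" by (rule T_cJ[OF p that]) simp
      then have "n \<bullet> (cJ (fst t), 0) = 0" by (rule n)
      then show ?thesis by (simp add: inner_prod_def cJ_inner)
    qed
    then have "P (cJ (fst n), 0) = 0" by (rule P0)
    moreover have "(cJ (fst (g' y (z, 0))), 0::real) = (cJ z, 0) + (cJ (fst n), 0)"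
      by (simp add: n_def linear_diff[OF linear_cJ])
    ultimately have "P (cJ (fst (g' y (z, 0))), 0) = (cJ z, 0)"
      using P(1,3) Jz by (metis add.right_neutral linear_add)
    then have "P (g' y (cJ z, 0) - (cJ (fst (g' y (z, 0))), 0)) = 0"
      using slope[OF y Jz] P(1) by (simp add: linear_diff)
    moreover have "(cJ (fst (g' y (z, 0))), 0) \<in> T (g y)"
      by (rule T_cJ[OF gM]) (use slope[OF y z] in auto)
    then have "g' y (cJ z, 0) - (cJ (fst (g' y (z, 0))), 0) \<in> T (g y)"
      using slope[OF y Jz] subspace_T[OF gM] by (simp add: subspace_diff)
    ultimately have "g' y (cJ z, 0) - (cJ (fst (g' y (z, 0))), 0) = 0" using P_inj[OF y] by blast
    then show ?thesis by simp
  qed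
  have curve: "\<exists>S c. open S \<and> convex S \<and> 0 \<in> S \<and> 1 \<in> S \<and> c 0 = q1 \<and> c (1::complex) = q2 \<and>
         (\<forall>s\<in>S. c s \<in> M \<inter> G \<and> (\<exists>D w. (c has_derivative D) (at s) \<and>
             (\<forall>\<zeta>. D \<zeta> \<in> T (c s) \<and> fst (D \<zeta>) = \<zeta> *s w)))"
    if q: "q1 \<in> M \<inter> W" "q2 \<in> M \<inter> W" for q1 q2
  proof -
    define z where "z = fst (P q2 - P q1)"
    define \<tau> where "\<tau> = snd (P q2 - P q1)"
    \<comment> \<open>Complex linear in the \<open>C^n\<close> part. The \<open>t\<close>-part
      depends on \<open>Re s\<close> only so that \<open>A 1\<close> hits
      \<open>P q2 - P q1\<close>; verticality keeps all values in \<open>T p\<close>.\<close>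
    define A :: "complex \<Rightarrow> 'n heis" where "A s = (s *s z, Re s * \<tau>)" for s
    have zT: "(z, t) \<in> T p" for t
      by (rule T_vertical[OF p, of "P q2 - P q1"]) (use P(2) Tp in \<open>auto simp: z_def subspace_diff\<close>)
    have AT: "A s \<in> T p" for s
      by (rule T_complex_scale[OF p zT[of 0], of _ s]) (simp add: A_def)
    have linA: "linear A"
      by (simp add: linear_iff A_def complex_scale_cJ algebra_simps)
    then have blA: "bounded_linear A" using linear_conv_bounded_linear by blast
    define S where "S = A -` ball (P p - P q1) r"
    have inS: "P q1 + A s \<in> ball (P p) r" if "s \<in> S" for s
      using that by (simp add: S_def dist_norm algebra_simps)
    have inT: "P q1 + A s \<in> T p" for s using AT P(2) Tp by (simp add: subspace_add)
    have S: "open S" "convex S"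
    proof -
      show "convex S" unfolding S_def by (rule convex_linear_vimage[OF linA]) simp
      show "open S" unfolding S_def
        using continuous_open_preimage[of UNIV A] linear_continuous_on[OF blA] by simp
    qed
    have A1: "A 1 = P q2 - P q1" "A 0 = 0" by (simp_all add: A_def z_def \<tau>_def prod_eq_iff)
    have S01: "0 \<in> S" "1 \<in> S"
      using g_P[OF q(1)] g_P[OF q(2)] A1 by (simp_all add: S_def dist_norm)
    let ?c = "\<lambda>s. g (P q1 + A s)"
    have der: "\<exists>D w. (?c has_derivative D) (at s) \<and> (\<forall>\<zeta>. D \<zeta> \<in> T (?c s) \<and> fst (D \<zeta>) = \<zeta> *s w)"
      if s: "s \<in> S" for s
    proof (intro exI conjI allI)
      let ?y = "P q1 + A s"
      let ?w = "fst (g' ?y (z, 0))"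
      have "((\<lambda>s. P q1 + A s) has_derivative A) (at s)"
        using bounded_linear_imp_has_derivative[OF blA] by (auto intro!: derivative_eq_intros)
      from has_derivative_compose[OF this g_deriv[OF inS[OF s]]]
      show "(?c has_derivative (\<lambda>\<zeta>. g' ?y (A \<zeta>))) (at s)" .
      fix \<zeta>
      show "g' ?y (A \<zeta>) \<in> T (?c s)" using slope[OF inS[OF s] inT AT] by blast
      have lin: "linear (g' ?y)" using g_deriv[OF inS[OF s]] has_derivative_linear by blast
      have "A \<zeta> = Re \<zeta> *\<^sub>R (z, 0) + Im \<zeta> *\<^sub>R (cJ z, 0) + (Re \<zeta> * \<tau>) *\<^sub>R Reeb"
        by (simp add: A_def Reeb_def complex_scale_cJ)
      then have "g' ?y (A \<zeta>) = Re \<zeta> *\<^sub>R g' ?y (z, 0) + Im \<zeta> *\<^sub>R g' ?y (cJ z, 0) + (Re \<zeta> * \<tau>) *\<^sub>R g' ?y Reeb"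
        by (simp only: linear_add[OF lin] linear_scale[OF lin])
      then show "fst (g' ?y (A \<zeta>)) = \<zeta> *s ?w"
        using g'_Reeb[OF inS[OF s] inT] g'_cJ[OF inS[OF s] inT zT]
        by (simp add: complex_scale_cJ Reeb_def)
    qed
    show ?thesis
      by (rule exI[of _ S], rule exI[of _ ?c])
        (use S S01 A1 der g_P[OF q(1)] g_P[OF q(2)] g_in[OF inS inT] in auto)
  qed
  then have "holomorphically_connected W G" by (simp add: holomorphically_connected_def)
  then show thesis using that[OF W(1-3)] by blast
qed

end

section \<open>The differential of a pseudohermitian transformation\<close>

text \<open>Smoothness controls the derivative of \<open>F\<close> along a fixed vector, while here
  the direction moves with the point. Expanding the direction in the basis separates the two
  dependencies.\<close>

lemma deriv_compose_differentiable:
  fixes F :: "'a::euclidean_space \<Rightarrow> 'b::real_normed_vector" and \<psi> :: "'c::real_normed_vector \<Rightarrow> 'a"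
  assumes F: "smooth_on U F" and \<psi>: "smooth_on V \<psi>" and y: "y \<in> V" "\<psi> y \<in> U"
  shows "(\<lambda>x. frechet_derivative F (at (\<psi> x)) (frechet_derivative \<psi> (at x) l)) differentiable (at y)"
proof -
  let ?W = "V \<inter> \<psi> -` U"
  have "continuous_on V \<psi>"
    using smooth_on_has_derivative[OF \<psi>] by (meson continuous_at_imp_continuous_on has_derivative_continuous)
  then have W: "open ?W" "y \<in> ?W"
    using F \<psi> y by (auto simp: smooth_on_def intro!: continuous_open_preimage)
  obtain A where A: "((\<lambda>x. frechet_derivative \<psi> (at x) l) has_derivative A) (at y)"
    using smooth_on_deriv_differentiable[OF \<psi> y(1)] unfolding differentiable_def by blast
  have "\<exists>C. ((\<lambda>x. frechet_derivative F (at (\<psi> x)) b) has_derivative C) (at y)" for b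
    using smooth_on_deriv_differentiable[OF F y(2), of b] smooth_on_has_derivative[OF \<psi> y(1)]
    unfolding differentiable_def using has_derivative_compose by blast
  then obtain C where C: "\<And>b. ((\<lambda>x. frechet_derivative F (at (\<psi> x)) b) has_derivative C b) (at y)"
    by metis
  let ?g = "\<lambda>x. \<Sum>b\<in>Basis. (frechet_derivative \<psi> (at x) l \<bullet> b) *\<^sub>R frechet_derivative F (at (\<psi> x)) b"
  have "?g differentiable (at y)"
    unfolding differentiable_def
    by (rule exI, rule has_derivative_sum, rule has_derivative_scaleR[OF has_derivative_inner_left[OF A] C])
  then obtain G where G: "(?g has_derivative G) (at y)" unfolding differentiable_def by blast
  have "((\<lambda>x. frechet_derivative F (at (\<psi> x)) (frechet_derivative \<psi> (at x) l)) has_derivative G) (at y)"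
  proof (rule has_derivative_transform_within_open[OF G W])
    fix x assume "x \<in> ?W"
    then have lin: "linear (frechet_derivative F (at (\<psi> x)))"
      using smooth_on_has_derivative[OF F] has_derivative_linear by blast
    let ?v = "frechet_derivative \<psi> (at x) l"
    have "frechet_derivative F (at (\<psi> x)) ?v = frechet_derivative F (at (\<psi> x)) (\<Sum>b\<in>Basis. (?v \<bullet> b) *\<^sub>R b)"
      by (simp add: euclidean_representation)
    also have "\<dots> = ?g x" by (simp add: linear_sum[OF lin] linear_scale[OF lin])
    finally show "?g x = frechet_derivative F (at (\<psi> x)) ?v" by simp
  qed
  then show ?thesis unfolding differentiable_def by blast
qed

text \<open>This is the rule that pullback commutes with the exterior derivative, in coordinates. In
  \<open>A l h\<close> the form is evaluated on \<open>l\<close> and differentiated along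
  \<open>h\<close>; antisymmetrising cancels the second derivatives of \<open>f\<close> and leaves
  the derivative of the coefficients of \<open>\<Theta>\<close>.\<close>

lemma Theta_pullback_exterior_derivative:
  fixes f :: "'a::real_normed_vector \<Rightarrow> 'n::finite heis"
  assumes V: "open V" "y \<in> V" "\<And>x. x \<in> V \<Longrightarrow> (f has_derivative f' x) (at x)"
    and d: "\<And>l. (\<lambda>x. f' x l) differentiable (at y)"
  obtains A where "\<And>l. ((\<lambda>x. Theta (f x) (f' x l)) has_derivative A l) (at y)"
    "\<And>l1 l2. A l1 l2 - A l2 l1 = dTheta (f' y l2) (f' y l1)"
proof -
  obtain B where B: "\<And>l. ((\<lambda>x. f' x l) has_derivative B l) (at y)"
    using d unfolding differentiable_def by metis
  define A where "A l h = snd (B l h) + (cJ (fst (f y)) \<bullet> fst (B l h) + cJ (fst (f' y h)) \<bullet> fst (f' y l))" for l h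
  have "((\<lambda>x. Theta (f x) (f' x l)) has_derivative A l) (at y)" for l
    unfolding Theta_cJ A_def
    by (intro has_derivative_add has_derivative_snd has_derivative_inner has_derivative_fst B
          bounded_linear.has_derivative[OF bounded_linear_cJ] V)
  moreover have "A l1 l2 - A l2 l1 = dTheta (f' y l2) (f' y l1)" for l1 l2
  proof -
    have "B l1 l2 = B l2 l1" using second_derivative_symmetric[OF V B B] .
    then show ?thesis
      using cJ_inner[of "fst (f' y l1)" "fst (f' y l2)"]
      by (simp add: A_def dTheta_cJ inner_commute)
  qed
  ultimately show thesis using that by blast
qed

lemma tangent_curve:
  assumes "v \<in> tangent_space K q"
  obtains c where "c 0 = q" "(c has_vector_derivative v) (at 0)" "\<forall>\<^sub>F s in at 0. c s \<in> K" "isCont c 0"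
proof -
  obtain c e where c: "0 < e" "c 0 = q" "\<forall>t\<in>{-e<..<e}. c t \<in> K" "(c has_vector_derivative v) (at (0::real))"
    using assms unfolding tangent_space_def by blast
  have "\<forall>\<^sub>F s in at 0. s \<in> {-e<..<e}"
    by (rule eventually_at_in_open') (use c in auto)
  then have "\<forall>\<^sub>F s in at 0. c s \<in> K" by eventually_elim (use c in blast)
  then show thesis using that c has_vector_derivative_continuous by blast
qed

section \<open>The tangential differential through an ambient extension\<close>

locale ph_transformation_vertical =
  M: vertical_ph_submanifold M m + N: vertical_ph_submanifold N m
  for M N :: "'n::finite heis set" and m :: nat +
  fixes \<phi> :: "'n heis \<Rightarrow> 'n heis"
  assumes trans: "ph_transformation M N \<phi>"
begin

lemma bij: "bij_betw \<phi> M N"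
  using trans by (simp add: ph_transformation_def diffeo_betw_def)

lemma phi_in_N: "q \<in> M \<Longrightarrow> \<phi> q \<in> N"
  using bij bij_betwE by blast

lemma extension_exists:
  assumes "p \<in> M"
  obtains U F where "p \<in> U" "smooth_on U F" "\<And>q. q \<in> M \<inter> U \<Longrightarrow> F q = \<phi> q"
  using trans assms unfolding ph_transformation_def diffeo_betw_def smooth_map_on_def by metis

end

text \<open>The extension \<open>F\<close> is fixed so that a derivative exists; on \<open>M\<close>
  only its values on tangent vectors are determined by \<open>\<phi>\<close>.\<close>

locale ph_transformation_extension = ph_transformation_vertical M N m \<phi>
  for M N :: "'n::finite heis set" and m \<phi> +
  fixes U :: "'n heis set" and F :: "'n heis \<Rightarrow> 'n heis"
  assumes smooth_F: "smooth_on U F" and F_eq: "\<And>q. q \<in> M \<inter> U \<Longrightarrow> F q = \<phi> q"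
begin

abbreviation "DF q \<equiv> frechet_derivative F (at q)"

lemma open_U: "open U"
  using smooth_F by (simp add: smooth_on_def)

lemma F_deriv: "q \<in> U \<Longrightarrow> (F has_derivative DF q) (at q)"
  using smooth_on_has_derivative[OF smooth_F] .

lemma linear_DF: "q \<in> U \<Longrightarrow> linear (DF q)"
  using F_deriv has_derivative_linear by blast

lemma Theta_DF: "q \<in> M \<inter> U \<Longrightarrow> v \<in> M.T q \<Longrightarrow> Theta (\<phi> q) (DF q v) = Theta q v"
  using trans smooth_F F_eq unfolding ph_transformation_def by (metis IntD1 IntD2)

lemma Jst_DF: "q \<in> M \<inter> U \<Longrightarrow> v \<in> xi_hat M q \<Longrightarrow> DF q (Jst q v) = Jst (\<phi> q) (DF q v)"
  using trans smooth_F F_eq unfolding ph_transformation_def by (metis IntD1 IntD2)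

lemma DF_tangent:
  assumes q: "q \<in> M \<inter> U" and v: "v \<in> M.T q"
  shows "DF q v \<in> N.T (\<phi> q)"
proof -
  obtain c where c: "c 0 = q" "(c has_vector_derivative v) (at 0)" "\<forall>\<^sub>F s in at 0. c s \<in> M" "isCont c 0"
    using tangent_curve[OF v] .
  have U: "\<forall>\<^sub>F s in at 0. c s \<in> U"
    using c(1,4) open_U q unfolding isCont_def by (metis IntD2 topological_tendstoD)
  have "((\<lambda>s. F (c s)) has_vector_derivative DF q v) (at 0)"
    using has_vector_derivative_chain_at[OF c(2), of F "DF q"] F_deriv[of q] q c(1) by simp
  moreover have "\<forall>\<^sub>F s in at 0. F (c s) \<in> N"
    using c(3) U by eventually_elim (use F_eq phi_in_N in auto)
  ultimately show ?thesis
    using curve_derivative_in_tangent_space[OF N.submanifold_M] q phi_in_N F_eq c(1) by auto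
qed

text \<open>A curve in \<open>N\<close> is pulled back by an extension of the inverse of
  \<open>\<phi>\<close>; applying \<open>F\<close> returns the curve near the parameter 0, so the
  derivatives agree. Surjectivity allows the image of \<open>Reeb\<close> to be tested against any
  vector tangent to \<open>N\<close>.\<close>

lemma DF_surj:
  assumes q: "q \<in> M \<inter> U" and u: "u \<in> N.T (\<phi> q)"
  obtains v where "v \<in> M.T q" "DF q v = u"
proof -
  let ?\<chi> = "inv_into M \<phi>"
  have \<chi>: "?\<chi> (\<phi> x) = x" if "x \<in> M" for x
    using bij that by (simp add: bij_betw_def)
  have \<chi>N: "?\<chi> y \<in> M" "\<phi> (?\<chi> y) = y" if "y \<in> N" for y
    using bij that by (auto simp: bij_betw_def inv_into_into f_inv_into_f)
  obtain U' F' where F': "\<phi> q \<in> U'" "smooth_on U' F'" "\<forall>y\<in>N \<inter> U'. F' y = ?\<chi> y"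
    using trans phi_in_N q unfolding ph_transformation_def diffeo_betw_def smooth_map_on_def by (metis IntD1)
  obtain c where c: "c 0 = \<phi> q" "(c has_vector_derivative u) (at 0)" "\<forall>\<^sub>F s in at 0. c s \<in> N" "isCont c 0"
    using tangent_curve[OF u] .
  have U': "\<forall>\<^sub>F s in at 0. c s \<in> U'"
    using c(1,4) F' unfolding isCont_def smooth_on_def by (metis topological_tendstoD)
  have F'q: "F' (\<phi> q) = q" using F' phi_in_N q \<chi> by auto
  let ?v = "frechet_derivative F' (at (\<phi> q)) u"
  have d: "((\<lambda>s. F' (c s)) has_vector_derivative ?v) (at 0)"
    using has_vector_derivative_chain_at[OF c(2), of F'] smooth_on_has_derivative[OF F'(2)] F'(1) c(1) by simp
  have evM: "\<forall>\<^sub>F s in at 0. F' (c s) \<in> M" using c(3) U' by eventually_elim (use F'(3) \<chi>N in auto)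
  have vT: "?v \<in> M.T q"
    using curve_derivative_in_tangent_space[OF M.submanifold_M _ d] q F'q c(1) evM by auto
  have "isCont (\<lambda>s. F' (c s)) 0" using d has_vector_derivative_continuous by blast
  then have evU: "\<forall>\<^sub>F s in at 0. F' (c s) \<in> U"
    using open_U q F'q c(1) unfolding isCont_def by (metis IntD2 topological_tendstoD)
  have "((\<lambda>s. F (F' (c s))) has_vector_derivative DF q ?v) (at 0)"
    using has_vector_derivative_chain_at[OF d, of F "DF q"] F_deriv[of q] q c(1) F'q by simp
  moreover have "((\<lambda>s. F (F' (c s))) has_vector_derivative u) (at 0)"
    using c(2) unfolding has_vector_derivative_def
  proof (rule has_derivative_transform_eventually)
    show "\<forall>\<^sub>F s in at 0. c s = F (F' (c s))"
      using c(3) U' evM evU by eventually_elim (use F_eq F'(3) \<chi>N in auto)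
  qed (use c(1) F'q F_eq q in auto)
  ultimately have "DF q ?v = u" by (rule vector_derivative_unique_at)
  then show thesis using that vT by blast
qed

text \<open>In a chart both pullbacks of \<open>\<Theta>\<close> agree along the linear subspace \<open>L\<close>, so their antisymmetrised
  derivatives in directions of \<open>L\<close> agree as well.\<close>

lemma dTheta_DF:
  assumes q: "q \<in> M \<inter> U" and v: "v \<in> M.T q" and w: "w \<in> M.T q"
  shows "dTheta (DF q v) (DF q w) = dTheta v w"
proof -
  obtain Uc V \<kappa> \<psi> L where "submanifold_chart M Uc V \<kappa> \<psi> L" "q \<in> Uc" "dim L = 2 * m + 1"
    using submanifold_chart_exists[OF M.submanifold_M, of q] q by blast
  then interpret C: submanifold_chart M Uc V \<kappa> \<psi> L by simp
  let ?y = "\<kappa> q"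
  have qU: "q \<in> M \<inter> Uc" using q \<open>q \<in> Uc\<close> by simp
  have yV: "?y \<in> V" using C.phi_in_V \<open>q \<in> Uc\<close> by simp
  have yL: "?y \<in> L" using C.mem_M_iff qU by blast
  have \<psi>y: "\<psi> ?y = q" using C.psi_phi \<open>q \<in> Uc\<close> by simp
  obtain l1 l2 where l: "l1 \<in> L" "l2 \<in> L" "v = C.D\<psi> ?y l1" "w = C.D\<psi> ?y l2"
    using C.tangent_space_eq[OF qU] v w by blast
  define V' where "V' = V \<inter> \<psi> -` U"
  have "continuous_on V \<psi>"
    using C.psi_deriv by (meson continuous_at_imp_continuous_on has_derivative_continuous)
  then have V': "open V'" "?y \<in> V'"
    unfolding V'_def using C.open_V open_U yV \<psi>y q by (auto intro!: continuous_open_preimage)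
  define f' where "f' x l = DF (\<psi> x) (C.D\<psi> x l)" for x l
  have fd: "((\<lambda>x. F (\<psi> x)) has_derivative f' x) (at x)" if "x \<in> V'" for x
    using has_derivative_compose[OF C.psi_deriv F_deriv, of x] that unfolding V'_def f'_def by simp
  have pd: "(\<psi> has_derivative C.D\<psi> x) (at x)" if "x \<in> V'" for x
    using that C.psi_deriv by (simp add: V'_def)
  have f2: "(\<lambda>x. f' x l) differentiable (at ?y)" for l
    unfolding f'_def by (rule deriv_compose_differentiable[OF smooth_F C.smooth_psi yV]) (use \<psi>y q in simp)
  obtain A where A: "\<And>l. ((\<lambda>x. Theta (F (\<psi> x)) (f' x l)) has_derivative A l) (at ?y)"
    "\<And>l1 l2. A l1 l2 - A l2 l1 = dTheta (f' ?y l2) (f' ?y l1)"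
    using Theta_pullback_exterior_derivative[OF V' fd f2] by blast
  obtain B where B: "\<And>l. ((\<lambda>x. Theta (\<psi> x) (C.D\<psi> x l)) has_derivative B l) (at ?y)"
    "\<And>l1 l2. B l1 l2 - B l2 l1 = dTheta (C.D\<psi> ?y l2) (C.D\<psi> ?y l1)"
    using Theta_pullback_exterior_derivative[OF V' pd smooth_on_deriv_differentiable[OF C.smooth_psi yV]]
    by blast
  have AB: "A l h = B l h" if "l \<in> L" "h \<in> L" for l h
  proof -
    let ?c = "\<lambda>s::real. ?y + s *\<^sub>R h"
    have cd: "(?c has_vector_derivative h) (at 0)" by (auto intro!: derivative_eq_intros)
    have eq: "Theta (F (\<psi> x)) (f' x l) = Theta (\<psi> x) (C.D\<psi> x l)" if x: "x \<in> V'" "x \<in> L" for x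
    proof -
      have 1: "\<psi> x \<in> M \<inter> U" using x C.psi_in_M by (simp add: V'_def)
      have 2: "\<psi> x \<in> Uc" "\<kappa> (\<psi> x) = x" using x C.psi_in_U C.phi_psi by (auto simp: V'_def)
      have "C.D\<psi> x l \<in> M.T (\<psi> x)" using C.tangent_space_eq[of "\<psi> x"] 1 2 \<open>l \<in> L\<close> by auto
      then show ?thesis using Theta_DF[OF 1] F_eq[OF 1] by (simp add: f'_def)
    qed
    have "isCont ?c 0" by (intro continuous_intros)
    then have ev: "\<forall>\<^sub>F s in at 0. ?c s \<in> V'"
      using V' topological_tendstoD[of ?c ?y "at 0" V'] by (simp add: isCont_def)
    have cL: "?c s \<in> L" for s using yL that C.subspace_L by (simp add: subspace_add subspace_scale)
    have "((\<lambda>s. Theta (F (\<psi> (?c s))) (f' (?c s) l)) has_vector_derivative A l h) (at 0)"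
      using has_vector_derivative_chain_at[OF cd, of "\<lambda>x. Theta (F (\<psi> x)) (f' x l)" "A l"] A(1) by simp
    then have "((\<lambda>s. Theta (\<psi> (?c s)) (C.D\<psi> (?c s) l)) has_vector_derivative A l h) (at 0)"
      unfolding has_vector_derivative_def
    proof (rule has_derivative_transform_eventually)
      show "\<forall>\<^sub>F s in at 0. Theta (F (\<psi> (?c s))) (f' (?c s) l) = Theta (\<psi> (?c s)) (C.D\<psi> (?c s) l)"
        using ev by eventually_elim (use eq cL in blast)
    qed (use eq[OF V'(2) yL] in auto)
    moreover have "((\<lambda>s. Theta (\<psi> (?c s)) (C.D\<psi> (?c s) l)) has_vector_derivative B l h) (at 0)"
      using has_vector_derivative_chain_at[OF cd, of "\<lambda>x. Theta (\<psi> x) (C.D\<psi> x l)" "B l"] B(1) by simp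
    ultimately show ?thesis by (rule vector_derivative_unique_at)
  qed
  have "dTheta (f' ?y l1) (f' ?y l2) = dTheta (C.D\<psi> ?y l1) (C.D\<psi> ?y l2)"
    using A(2)[of l2 l1] B(2)[of l2 l1] AB l by simp
  then show ?thesis by (simp add: f'_def l \<psi>y)
qed

text \<open>\<open>Reeb\<close> annihilates \<open>dTheta\<close> and has \<open>Theta\<close> equal
  to 1, and both properties are transported. Pairing its image \<open>?u\<close> with the tangent
  vector \<open>(cJ (fst ?u), 0)\<close> yields twice the squared norm of \<open>fst ?u\<close>,
  which must therefore vanish.\<close>

lemma DF_Reeb:
  assumes q: "q \<in> M \<inter> U"
  shows "DF q Reeb = Reeb"
proof -
  have qM: "q \<in> M" using q by simp
  have \<phi>N: "\<phi> q \<in> N" using phi_in_N[OF qM] .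
  note R = M.Reeb_T[OF qM]
  let ?u = "DF q Reeb"
  have uT: "?u \<in> N.T (\<phi> q)" using DF_tangent[OF q R] .
  have "(cJ (fst ?u), 0) \<in> N.T (\<phi> q)" by (rule N.T_cJ[OF \<phi>N uT]) simp
  then obtain v where v: "v \<in> M.T q" "DF q v = (cJ (fst ?u), 0)" using DF_surj[OF q] by blast
  have "dTheta ?u (cJ (fst ?u), 0) = dTheta Reeb v"
    using dTheta_DF[OF q R v(1)] v(2) by simp
  then have "fst ?u = 0" by (simp add: dTheta_cJ Reeb_def linear_0[OF linear_cJ])
  moreover have "Theta (\<phi> q) ?u = 1" using Theta_DF[OF q R] by (simp add: Theta_cJ Reeb_def)
  ultimately show ?thesis by (simp add: Theta_cJ Reeb_def prod_eq_iff)
qed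

text \<open>Since \<open>Reeb\<close> is mapped to itself, the differential descends to the
  \<open>C^n\<close> parts.\<close>

lemma fst_DF_cong:
  assumes q: "q \<in> M \<inter> U" and "fst v = fst w"
  shows "fst (DF q v) = fst (DF q w)"
proof -
  have "v = w + (snd v - snd w) *\<^sub>R Reeb" using assms(2) by (simp add: Reeb_def prod_eq_iff)
  then have "DF q v = DF q (w + (snd v - snd w) *\<^sub>R Reeb)" by (rule arg_cong)
  also have "\<dots> = DF q w + (snd v - snd w) *\<^sub>R Reeb"
    using linear_DF[of q] q DF_Reeb[OF q] by (simp add: linear_add linear_scale)
  finally show ?thesis by (simp add: Reeb_def)
qed

text \<open>Compatibility with \<open>Jst\<close> is given on \<open>xi_hat\<close> only; passing to
  the \<open>C^n\<close> parts makes the Reeb component removed from \<open>v\<close>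
  invisible.\<close>

lemma fst_DF_cJ:
  assumes q: "q \<in> M \<inter> U" and v: "v \<in> M.T q" and w: "fst w = cJ (fst v)"
  shows "fst (DF q w) = cJ (fst (DF q v))"
proof -
  let ?h = "v - Theta q v *\<^sub>R Reeb"
  have h: "?h \<in> xi_hat M q" using M.horizontal_part v q by blast
  have "fst (DF q w) = fst (DF q (Jst q ?h))"
    by (rule fst_DF_cong[OF q]) (simp add: Jst_cJ w Reeb_def)
  also have "\<dots> = cJ (fst (DF q ?h))" using Jst_DF[OF q h] by (simp add: Jst_cJ)
  also have "fst (DF q ?h) = fst (DF q v)"
    by (rule fst_DF_cong[OF q]) (simp add: Reeb_def)
  finally show ?thesis .
qed

lemma fst_DF_complex_scale:
  assumes q: "q \<in> M \<inter> U" and v: "v \<in> M.T q" and w: "fst w = s *s fst v"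
  shows "fst (DF q w) = s *s fst (DF q v)"
proof -
  have "fst (DF q w) = fst (DF q (Re s *\<^sub>R v + Im s *\<^sub>R (cJ (fst v), 0)))"
    by (rule fst_DF_cong[OF q]) (simp add: w complex_scale_cJ)
  also have "\<dots> = Re s *\<^sub>R fst (DF q v) + Im s *\<^sub>R fst (DF q (cJ (fst v), 0))"
    using linear_DF[of q] q by (simp only: IntD2 linear_add linear_scale fst_add fst_scaleR)
  also have "fst (DF q (cJ (fst v), 0)) = cJ (fst (DF q v))"
    by (rule fst_DF_cJ[OF q v]) simp
  finally show ?thesis by (simp add: complex_scale_cJ)
qed

text \<open>Pairing \<open>v\<close> with its multiple by \<open>\<i>\<close> under
  \<open>dTheta\<close> gives twice the squared norm of \<open>fst v\<close>, and both ingredients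
  are preserved.\<close>

lemma norm_fst_DF:
  assumes q: "q \<in> M \<inter> U" and v: "v \<in> M.T q"
  shows "norm (fst (DF q v)) = norm (fst v)"
proof -
  have w: "(cJ (fst v), 0) \<in> M.T q" by (rule M.T_cJ[OF _ v]) (use q in auto)
  have "dTheta (DF q v) (DF q (cJ (fst v), 0)) = dTheta v (cJ (fst v), 0)"
    using dTheta_DF[OF q v w] .
  moreover have "fst (DF q (cJ (fst v), 0)) = cJ (fst (DF q v))"
    by (rule fst_DF_cJ[OF q v]) simp
  ultimately show ?thesis by (simp add: dTheta_cJ norm_eq_sqrt_inner)
qed

text \<open>The connecting curve and its image under \<open>F\<close> both project to holomorphic
  curves in \<open>C^n\<close>, with equal speeds because the differential preserves norms of
  \<open>C^n\<close> parts. Equal speeds then give equal chords.\<close>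

lemma chord_isometry:
  assumes curves: "M.holomorphically_connected W U" and q: "q1 \<in> M \<inter> W" "q2 \<in> M \<inter> W"
  shows "norm (fst (\<phi> q1) - fst (\<phi> q2)) = norm (fst q1 - fst q2)"
proof -
  obtain S c where S: "open S" "convex S" "0 \<in> S" "1 \<in> S" and c01: "c 0 = q1" "c (1::complex) = q2"
    and c: "\<forall>s\<in>S. c s \<in> M \<inter> U \<and> (\<exists>D w. (c has_derivative D) (at s) \<and>
           (\<forall>\<zeta>. D \<zeta> \<in> M.T (c s) \<and> fst (D \<zeta>) = \<zeta> *s w))"
    using curves q unfolding M.holomorphically_connected_def by blast
  have "\<forall>s. \<exists>D w. s \<in> S \<longrightarrow> (c has_derivative D) (at s) \<and> (\<forall>\<zeta>. D \<zeta> \<in> M.T (c s) \<and> fst (D \<zeta>) = \<zeta> *s w)"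
    using c by blast
  then obtain D w where D: "\<And>s. s \<in> S \<Longrightarrow> (c has_derivative D s) (at s)"
     "\<And>s \<zeta>. s \<in> S \<Longrightarrow> D s \<zeta> \<in> M.T (c s)" "\<And>s \<zeta>. s \<in> S \<Longrightarrow> fst (D s \<zeta>) = \<zeta> *s w s"
    by metis
  have cM: "c s \<in> M \<inter> U" if "s \<in> S" for s using c that by blast
  let ?a' = "\<lambda>s. fst (DF (c s) (D s 1))"
  have w: "w s = fst (D s 1)" if "s \<in> S" for s using D(3)[OF that, of 1] by simp
  have "norm (fst (F (c 1)) - fst (F (c 0))) = norm (fst (c 1) - fst (c 0))"
  proof (rule holomorphic_curve_chord_eq[OF S, where a = "\<lambda>s. fst (F (c s))" and a' = ?a' and b' = w])
    fix s assume s: "s \<in> S"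
    show "((\<lambda>s. fst (c s)) has_derivative (\<lambda>\<zeta>. \<zeta> *s w s)) (at s)"
      using has_derivative_fst[OF D(1)[OF s]] D(3)[OF s] by simp
    have "((\<lambda>s. fst (F (c s))) has_derivative (\<lambda>\<zeta>. fst (DF (c s) (D s \<zeta>)))) (at s)"
      using has_derivative_fst[OF has_derivative_compose[OF D(1)[OF s] F_deriv]] cM[OF s] by blast
    moreover have "(\<lambda>\<zeta>. fst (DF (c s) (D s \<zeta>))) = (\<lambda>\<zeta>. \<zeta> *s ?a' s)"
      by (rule ext, rule fst_DF_complex_scale[OF cM[OF s] D(2)[OF s]]) (use D(3)[OF s] in simp)
    ultimately show "((\<lambda>s. fst (F (c s))) has_derivative (\<lambda>\<zeta>. \<zeta> *s ?a' s)) (at s)"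
      by (rule has_derivative_eq_rhs)
    show "norm (?a' s) = norm (w s)"
      using norm_fst_DF[OF cM[OF s] D(2)[OF s]] w[OF s] by simp
  qed
  moreover have "F (c 0) = \<phi> q1" "F (c 1) = \<phi> q2" using F_eq cM[OF S(3)] cM[OF S(4)] c01 by auto
  ultimately show ?thesis using c01 by (simp add: norm_minus_commute)
qed

end

text \<open>The holomorphic curves serve here as differentiable maps from a convex parameter set
  into \<open>M\<close>, joining the two points; along them \<open>h\<close> has derivative
  zero.\<close>

lemma (in vertical_ph_submanifold) constant_if_tangential_derivative_zero:
  fixes h :: "'n heis \<Rightarrow> real"
  assumes curves: "holomorphically_connected W U" and q: "q1 \<in> M \<inter> W" "q2 \<in> M \<inter> W"
    and h: "\<And>q. q \<in> M \<inter> U \<Longrightarrow> (h has_derivative h' q) (at q)"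
      "\<And>q v. q \<in> M \<inter> U \<Longrightarrow> v \<in> T q \<Longrightarrow> h' q v = 0"
  shows "h q1 = h q2"
proof -
  obtain S c where S: "open S" "convex S" "0 \<in> S" "1 \<in> S" and c01: "c 0 = q1" "c (1::complex) = q2"
    and c: "\<forall>s\<in>S. c s \<in> M \<inter> U \<and> (\<exists>D w. (c has_derivative D) (at s) \<and>
           (\<forall>\<zeta>. D \<zeta> \<in> T (c s) \<and> fst (D \<zeta>) = \<zeta> *s w))"
    using curves q unfolding holomorphically_connected_def by blast
  have "((\<lambda>s. h (c s)) has_derivative (\<lambda>_. 0)) (at s within S)" if s: "s \<in> S" for s
  proof -
    obtain D where D: "(c has_derivative D) (at s)" "\<And>\<zeta>. D \<zeta> \<in> T (c s)" using c s by blast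
    have cM: "c s \<in> M \<inter> U" using c s by blast
    have "((\<lambda>s. h (c s)) has_derivative (\<lambda>\<zeta>. h' (c s) (D \<zeta>))) (at s)"
      using has_derivative_compose[OF D(1) h(1)[OF cM]] .
    then show ?thesis using h(2)[OF cM D(2)] by (simp add: has_derivative_at_withinI)
  qed
  from has_derivative_zero_unique[OF S(2) this S(3,4)] show ?thesis using c01 by simp
qed

section \<open>Rigidity\<close>

lemma span_eq_UNIV_if_no_normal:
  fixes X :: "'a::euclidean_space set"
  assumes "\<And>a. (\<And>x. x \<in> X \<Longrightarrow> a \<bullet> x = 0) \<Longrightarrow> a = 0"
  shows "span X = UNIV"
proof (rule ccontr)
  assume "span X \<noteq> UNIV"
  then have "dim X < DIM('a)" using dim_eq_full[of X] dim_subset_UNIV[of X] by linarith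
  then obtain a where "a \<noteq> 0" "span X \<subseteq> {x. a \<bullet> x = 0}" using lowdim_subset_hyperplane by metis
  then show False using assms span_superset by blast
qed

text \<open>Distances within a family determine the inner products of its differences from a base
  point. \<open>R\<close> is prescribed on a basis chosen among the differences of
  \<open>h1\<close>, and equality of the inner products makes it orthogonal.\<close>

lemma isometric_families_congruent:
  fixes h1 h2 :: "'i \<Rightarrow> 'a::euclidean_space"
  assumes i0: "i0 \<in> I"
    and iso: "\<And>i j. i \<in> I \<Longrightarrow> j \<in> I \<Longrightarrow> norm (h2 i - h2 j) = norm (h1 i - h1 j)"
    and full: "span ((\<lambda>i. h1 i - h1 i0) ` I) = UNIV"
  obtains R where "orthogonal_transformation R" "\<And>i. i \<in> I \<Longrightarrow> h2 i - h2 i0 = R (h1 i - h1 i0)"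
proof -
  let ?d1 = "\<lambda>i. h1 i - h1 i0" and ?d2 = "\<lambda>i. h2 i - h2 i0"
  have ip: "?d2 i \<bullet> ?d2 j = ?d1 i \<bullet> ?d1 j" if "i \<in> I" "j \<in> I" for i j
    using iso[OF that(1) i0] iso[OF that(2) i0] iso[OF that] by (simp add: dot_norm_neg)
  obtain B where B: "B \<subseteq> ?d1 ` I" "independent B" "?d1 ` I \<subseteq> span B"
    using maximal_independent_subset by blast
  have spB: "span B = UNIV"
    using full B(3) span_mono span_span by (metis top.extremum_uniqueI)
  let ?s = "inv_into I ?d1"
  have s: "?s b \<in> I" "?d1 (?s b) = b" if "b \<in> B" for b
    using that B(1) inv_into_into[of b ?d1 I] f_inv_into_f[of b ?d1 I] by auto
  obtain R where R: "linear R" "\<forall>b\<in>B. R b = ?d2 (?s b)"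
    using linear_independent_extend[OF B(2), where f = "\<lambda>b. ?d2 (?s b)"] by auto
  have RB: "R x \<bullet> R b = x \<bullet> b" if "b \<in> B" for x b
  proof -
    have "x \<in> span B" using spB by simp
    then show ?thesis
    proof (induction rule: span_induct)
      case base
      show ?case by (auto simp: subspace_def linear_0[OF R(1)] linear_add[OF R(1)] linear_scale[OF R(1)] inner_add_left)
    next
      case (step x)
      then show ?case using R(2) ip[OF s(1) s(1)] s(2) that by simp
    qed
  qed
  have RR: "R x \<bullet> R y = x \<bullet> y" for x y
  proof -
    have "y \<in> span B" using spB by simp
    then show ?thesis
    proof (induction rule: span_induct)
      case base
      show ?case by (auto simp: subspace_def linear_0[OF R(1)] linear_add[OF R(1)] linear_scale[OF R(1)] inner_add_right)
    qed (use RB in auto)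
  qed
  have orth: "orthogonal_transformation R"
    using R(1) RR by (simp add: orthogonal_transformation_def)
  have "?d2 i = R (?d1 i)" if i: "i \<in> I" for i
  proof -
    \<comment> \<open>An index outside the chosen basis: the defect is orthogonal to the range of
      \<open>R\<close>, which is the whole space because \<open>R\<close> is orthogonal, so the
      defect is zero.\<close>
    have "(?d2 i - R (?d1 i)) \<bullet> R x = 0" for x
    proof -
      have "x \<in> span B" using spB by simp
      then show ?thesis
      proof (induction rule: span_induct)
        case base
        show ?case
          by (auto simp: subspace_def linear_0[OF R(1)] linear_add[OF R(1)] linear_scale[OF R(1)] inner_add_right)
      next
        case (step b)
        have "?d2 i \<bullet> R b = ?d1 i \<bullet> b" using R(2) ip[OF i s(1)] s(2) step by simp
        then show ?case by (simp add: inner_diff_left RR)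
      qed
    qed
    moreover obtain x where "R x = ?d2 i - R (?d1 i)"
      using orthogonal_transformation_surj[OF orth] by (metis surjD)
    ultimately show ?thesis by (metis eq_iff_diff_eq_0 inner_eq_zero_iff)
  qed
  then show thesis using that orth by blast
qed

text \<open>Lets an identity that holds only on \<open>M\<close> be differentiated, in tangential
  directions, by restricting both sides to a curve in \<open>M\<close>.\<close>

lemma tangent_derivative_cong:
  assumes W: "open W" "q \<in> M \<inter> W" and v: "v \<in> tangent_space M q"
    and f: "(f has_derivative f') (at q)" and g: "(g has_derivative g') (at q)"
    and eq: "\<And>x. x \<in> M \<inter> W \<Longrightarrow> f x = g x"
  shows "f' v = g' v"
proof -
  obtain c where c: "c 0 = q" "(c has_vector_derivative v) (at 0)" "\<forall>\<^sub>F s in at 0. c s \<in> M" "isCont c 0"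
    using tangent_curve[OF v] .
  have ev: "\<forall>\<^sub>F s in at 0. c s \<in> W"
    using c(1,4) W unfolding isCont_def by (metis IntD2 topological_tendstoD)
  have "((\<lambda>s. f (c s)) has_vector_derivative f' v) (at 0)"
    using has_vector_derivative_chain_at[OF c(2), of f f'] f c(1) by simp
  then have "((\<lambda>s. g (c s)) has_vector_derivative f' v) (at 0)"
    unfolding has_vector_derivative_def
  proof (rule has_derivative_transform_eventually)
    show "\<forall>\<^sub>F s in at 0. f (c s) = g (c s)" using ev c(3) by eventually_elim (use eq in auto)
  qed (use eq W c(1) in auto)
  moreover have "((\<lambda>s. g (c s)) has_vector_derivative g' v) (at 0)"
    using has_vector_derivative_chain_at[OF c(2), of g g'] g c(1) by simp
  ultimately show ?thesis by (rule vector_derivative_unique_at)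
qed

section \<open>Complex hyperplanes and the span of the tangent spaces\<close>

lemma dim_complex_hyperplane:
  fixes a :: "complex^'n::finite"
  assumes "a \<noteq> 0"
  shows "dim {e. a \<bullet> e = 0 \<and> cJ a \<bullet> e = 0} = 2 * (CARD('n) - 1)"
proof -
  let ?A = "{a, cJ a}"
  have orth: "a \<bullet> cJ a = 0" using cJ_inner[of a a] by (simp add: inner_commute)
  have Ja: "cJ a \<noteq> 0" using assms norm_cJ[of a] by (metis norm_eq_zero)
  have ne: "a \<noteq> cJ a" using orth assms by (metis inner_eq_zero_iff)
  have "pairwise orthogonal ?A"
    using orth by (auto simp: pairwise_def orthogonal_def inner_commute)
  then have "independent ?A"
    by (rule pairwise_orthogonal_independent) (use assms Ja in auto)
  then have "dim (span ?A) = 2"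
    using dim_eq_card_independent[of ?A] ne by simp
  moreover have "dim {y \<in> UNIV. \<forall>x\<in>span ?A. orthogonal x y} + dim (span ?A) = dim (UNIV :: (complex^'n) set)"
    by (rule dim_subspace_orthogonal_to_vectors) auto
  moreover have "{y \<in> UNIV. \<forall>x\<in>span ?A. orthogonal x y} = {e. a \<bullet> e = 0 \<and> cJ a \<bullet> e = 0}"
  proof (intro set_eqI iffI)
    fix y assume "y \<in> {e. a \<bullet> e = 0 \<and> cJ a \<bullet> e = 0}"
    then have "orthogonal y x" if "x \<in> span ?A" for x
      using that by (intro orthogonal_to_span[of x ?A y]) (auto simp: orthogonal_def inner_commute)
    then show "y \<in> {y \<in> UNIV. \<forall>x\<in>span ?A. orthogonal x y}" by (simp add: orthogonal_commute)
  qed (auto simp: orthogonal_def span_base)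
  moreover have "dim (UNIV :: (complex^'n) set) = 2 * CARD('n)"
    by (simp add: dim_UNIV)
  moreover have "CARD('n) \<ge> 1" by (simp add: Suc_leI)
  ultimately show ?thesis by simp
qed

context vertical_ph_submanifold
begin

text \<open>A common real normal \<open>a\<close> of the tangent spaces is also a complex normal since these are complex,
  so by dimension the tangent spaces all coincide with the fixed complex hyperplane \<open>a\<^sup>\<bottom>\<close>.\<close>

lemma flat_point_if_common_normal:
  assumes m: "m = CARD('n) - 1" and p: "p \<in> M" and W: "open W" "p \<in> W"
    and a: "a \<noteq> 0" "\<And>q v. q \<in> M \<inter> W \<Longrightarrow> v \<in> T q \<Longrightarrow> a \<bullet> fst v = 0"
  shows "flat_point M p"
proof -
  define H where "H = {e. a \<bullet> e = 0 \<and> cJ a \<bullet> e = 0}"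
  have subH: "subspace H" by (auto simp: H_def subspace_def inner_add_right)
  have TH: "fst ` T q = H" if q: "q \<in> M \<inter> W" for q
  proof (rule subspace_dim_equal)
    have qM: "q \<in> M" using q by simp
    show "subspace (fst ` T q)" "subspace H" using dim_fst_T(1)[OF qM] subH by auto
    show "fst ` T q \<subseteq> H"
    proof
      fix e assume "e \<in> fst ` T q"
      then obtain v where v: "v \<in> T q" "e = fst v" by blast
      have "(cJ (fst v), 0) \<in> T q" by (rule T_cJ[OF qM v(1)]) simp
      then have "a \<bullet> cJ e = 0" using a(2)[OF q] v by force
      then show "e \<in> H" using a(2)[OF q v(1)] v(2) by (simp add: H_def cJ_inner)
    qed
    show "dim (fst ` T q) \<ge> dim H"
      using dim_fst_T(2)[OF qM] dim_complex_hyperplane[OF a(1)] m by (simp add: H_def)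
  qed
  show ?thesis
    unfolding flat_point_def
  proof (intro allI impI ballI)
    fix U X Y \<nu>
    assume X: "p \<in> U \<and> smooth_on U X \<and> (\<forall>q\<in>M \<inter> U. X q \<in> xi_hat M q)"
      and Y: "Y \<in> T p" and \<nu>: "\<nu> \<in> xi_perp M p"
    obtain c where c: "c 0 = p" "(c has_vector_derivative Y) (at 0)" "\<forall>\<^sub>F s in at 0. c s \<in> M" "isCont c 0"
      using tangent_curve[OF Y] .
    let ?D = "frechet_derivative X (at p)"
    have "((\<lambda>q. fst (X q)) has_derivative (\<lambda>v. fst (?D v))) (at p)"
      using smooth_on_has_derivative X has_derivative_fst by blast
    then have d: "((\<lambda>s. fst (X (c s))) has_vector_derivative fst (?D Y)) (at 0)"
      using has_vector_derivative_chain_at[OF c(2), of "\<lambda>q. fst (X q)" "\<lambda>v. fst (?D v)"] c(1) by simp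
    have XH: "fst (X q) \<in> H" if "q \<in> M \<inter> W" "q \<in> U" for q
      using X TH[OF that(1)] that by (auto simp: xi_hat_def)
    have "open (W \<inter> U)" using X W by (auto simp: smooth_on_def)
    then have "\<forall>\<^sub>F s in at 0. c s \<in> W \<inter> U"
      using c(1,4) W X unfolding isCont_def by (metis IntI topological_tendstoD)
    then have ev: "\<forall>\<^sub>F s in at 0. fst (X (c s)) \<in> H"
      using c(3) by eventually_elim (use XH in blast)
    \<comment> \<open>Along \<open>c\<close> the field has its \<open>C^n\<close> part in the fixed
      space \<open>H\<close>, so its derivative stays in \<open>H\<close>, which is also the
      projection of \<open>xi_hat M p\<close>. The connection differentiates just this
      \<open>C^n\<close> part, hence there is no component along \<open>\<nu>\<close>.\<close>
    have "fst (?D Y) \<in> H"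
      by (rule derivative_in_subspace[OF d subH _ ev]) (use XH p W X c(1) in auto)
    then have "fst (?D Y) \<in> fst ` xi_hat M p" using TH p W fst_xi_hat[OF p] by blast
    then obtain w where w: "w \<in> xi_hat M p" "fst (?D Y) = fst w" by blast
    have "levi p \<nu> w = 0" using \<nu> w(1) by (simp add: xi_perp_def)
    then show "levi p (ps_nabla p X Y) \<nu> = 0"
      by (simp add: levi_inner fst_ps_nabla w(2) inner_commute)
  qed
qed

text \<open>The form in which non-flatness is used: a linear map is determined by its values on
  tangent vectors near \<open>p\<close>. This yields complex linearity and uniqueness of the rigid
  motion.\<close>

lemma span_tangent_spaces:
  assumes "m = CARD('n) - 1" "p \<in> M" "\<not> flat_point M p" "open W" "p \<in> W"
  shows "span (\<Union>q\<in>M \<inter> W. fst ` T q) = UNIV"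
proof (rule span_eq_UNIV_if_no_normal)
  fix a assume "\<And>x. x \<in> (\<Union>q\<in>M \<inter> W. fst ` T q) \<Longrightarrow> a \<bullet> x = 0"
  then have "\<And>q v. q \<in> M \<inter> W \<Longrightarrow> v \<in> T q \<Longrightarrow> a \<bullet> fst v = 0" by blast
  then show "a = 0" using flat_point_if_common_normal assms by blast
qed

text \<open>A vector normal to all chords from \<open>p\<close> is, after differentiation along
  \<open>M\<close>, normal to all nearby tangent spaces. Full span of the chords lets the congruence
  be defined on all of \<open>C^n\<close>.\<close>

lemma span_chords:
  assumes "m = CARD('n) - 1" "p \<in> M" "\<not> flat_point M p" "open W" "p \<in> W"
  shows "span ((\<lambda>q. fst q - fst p) ` (M \<inter> W)) = UNIV"
proof (rule span_eq_UNIV_if_no_normal)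
  fix a assume a: "\<And>x. x \<in> (\<lambda>q. fst q - fst p) ` (M \<inter> W) \<Longrightarrow> a \<bullet> x = 0"
  have "a \<bullet> fst v = 0" if q: "q \<in> M \<inter> W" and v: "v \<in> T q" for q v
  proof (rule tangent_derivative_cong[OF assms(4) q v])
    show "((\<lambda>x. a \<bullet> (fst x - fst p)) has_derivative (\<lambda>v. a \<bullet> fst v)) (at q)"
      by (auto intro!: derivative_eq_intros)
    show "((\<lambda>x. 0) has_derivative (\<lambda>v. 0)) (at q)" by simp
  qed (use a in auto)
  then show "a = 0" using flat_point_if_common_normal assms by blast
qed

end

text \<open>A unitary rotation followed by a left translation of the Heisenberg group, once
  \<open>R\<close> is orthogonal and commutes with \<open>cJ\<close>. The term
  \<open>- cJ b \<bullet> R (fst q)\<close> cancels the contribution of the shift \<open>b\<close>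
  to \<open>Theta\<close>.\<close>

definition rigid_motion :: "(complex^'n::finite \<Rightarrow> complex^'n) \<Rightarrow> complex^'n \<Rightarrow> real \<Rightarrow> 'n heis \<Rightarrow> 'n heis" where
  "rigid_motion R b c q = (R (fst q) + b, snd q + c - cJ b \<bullet> R (fst q))"

lemma rigid_motion_affine:
  "rigid_motion R b c q = (b, c) + (R (fst q), snd q - cJ b \<bullet> R (fst q))"
  by (simp add: rigid_motion_def)

lemma rigid_motion_PSH:
  assumes R: "orthogonal_transformation R" and J: "\<And>x. R (cJ x) = cJ (R x)"
  shows "rigid_motion R b c \<in> PSH"
proof -
  let ?\<Phi> = "rigid_motion R b c"
  let ?R' = "inv R"
  have lR: "linear R" and ip: "\<And>x y. R x \<bullet> R y = x \<bullet> y"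
    using R by (auto simp: orthogonal_transformation_def)
  have R'R: "?R' (R x) = x" for x using orthogonal_transformation_inj[OF R] by simp
  have RR': "R (?R' x) = x" for x using orthogonal_transformation_surj[OF R] by (simp add: surj_f_inv_f)
  have lR': "linear ?R'"
    using orthogonal_transformation_inv[OF R] orthogonal_transformation_linear by blast
  \<comment> \<open>Because of this orthogonality, \<open>cJ b \<bullet> R z\<close> can be read off
    from the image point \<open>R z + b\<close>, which explains the \<open>t\<close>-component of
    the inverse \<open>\<Psi>\<close>.\<close>
  have bJb: "cJ b \<bullet> b = 0" using cJ_inner[of b b] by (simp add: inner_commute)
  define L where "L v = (R (fst v), snd v - cJ b \<bullet> R (fst v))" for v :: "'a heis"
  define L' where "L' v = (?R' (fst v), snd v + cJ b \<bullet> fst v)" for v :: "'a heis"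
  define \<Psi> where "\<Psi> q = (- ?R' b, - c) + L' q" for q
  have \<Phi>: "?\<Phi> = (\<lambda>q. (b, c) + L q)"
    by (auto simp: rigid_motion_affine L_def)
  have lL: "bounded_linear L" and lL': "bounded_linear L'"
    unfolding linear_conv_bounded_linear[symmetric]
    by (simp_all add: linear_iff L_def L'_def linear_add[OF lR] linear_scale[OF lR] linear_add[OF lR']
        linear_scale[OF lR'] inner_add_right algebra_simps)
  have inv1: "\<Psi> (?\<Phi> q) = q" for q
    by (simp add: \<Psi>_def L'_def rigid_motion_def linear_add[OF lR'] R'R inner_add_right bJb prod_eq_iff)
  have inv2: "?\<Phi> (\<Psi> q) = q" for q
    by (simp add: \<Psi>_def L'_def rigid_motion_def linear_add[OF lR] linear_diff[OF lR] RR' inner_diff_right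
        inner_add_right bJb prod_eq_iff)
  have bij: "bij_betw ?\<Phi> UNIV UNIV"
    using inv1 inv2 by (metis bij_betw_byWitness subset_UNIV UNIV_I)
  have inv: "inv ?\<Phi> = \<Psi>" using inv1 inv2 by (metis inv_equality)
  have "smooth_map_on UNIV ?\<Phi>" "smooth_map_on UNIV \<Psi>"
    unfolding smooth_map_on_def \<Phi> \<Psi>_def
    using smooth_on_affine[OF lL] smooth_on_affine[OF lL'] by blast+
  then have diffeo: "diffeo_betw UNIV UNIV ?\<Phi>"
    using bij inv by (simp add: diffeo_betw_def)
  \<comment> \<open>Every admissible extension agrees with the motion on an open set, so the
    conditions for arbitrary extensions reduce to the linear part \<open>L\<close>.\<close>
  have der: "frechet_derivative F (at p) = L"
    if "p \<in> U" "smooth_on U F" "\<forall>q\<in>UNIV \<inter> U. F q = ?\<Phi> q" for p U F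
  proof -
    have "frechet_derivative F (at p) = frechet_derivative ?\<Phi> (at p)"
      by (rule frechet_derivative_cong_open[of U]) (use that in \<open>auto simp: smooth_on_def\<close>)
    moreover have "(?\<Phi> has_derivative L) (at p)"
      unfolding \<Phi> using bounded_linear_imp_has_derivative[OF lL] by (auto intro!: derivative_eq_intros)
    ultimately show ?thesis using frechet_derivative_at by metis
  qed
  have Th: "Theta (?\<Phi> p) (L v) = Theta p v" for p v
    by (simp add: Theta_cJ rigid_motion_def L_def linear_add[OF linear_cJ] inner_add_left J[symmetric] ip)
  have Js: "L (Jst p v) = Jst (?\<Phi> p) (L v)" for p v
    by (simp add: Jst_cJ rigid_motion_def L_def J inner_add_left ip)
  show ?thesis
    unfolding PSH_def ph_transformation_def mem_Collect_eq
  proof (intro conjI ballI allI impI diffeo; elim conjE)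
    fix p U F v assume F: "p \<in> U" "smooth_on U F" "\<forall>q\<in>UNIV \<inter> U. F q = ?\<Phi> q"
    show "Theta (?\<Phi> p) (frechet_derivative F (at p) v) = Theta p v"
      "frechet_derivative F (at p) (Jst p v) = Jst (?\<Phi> p) (frechet_derivative F (at p) v)"
      using der[OF F] Th Js by simp_all
  qed
qed

text \<open>Differentiating along \<open>M\<close> gives equal linear parts on the tangent spaces,
  which span; the value at the single point \<open>p\<close> then fixes \<open>b\<close> and, after
  it, \<open>c\<close>.\<close>

lemma (in vertical_ph_submanifold) rigid_motion_unique:
  assumes nonflat: "m = CARD('n) - 1" "p \<in> M" "\<not> flat_point M p" and W: "open W" "p \<in> W"
    and R1: "orthogonal_transformation R1" and R2: "orthogonal_transformation R2"
    and eq: "\<And>q. q \<in> M \<inter> W \<Longrightarrow> rigid_motion R1 b1 c1 q = rigid_motion R2 b2 c2 q"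
  shows "rigid_motion R1 b1 c1 = rigid_motion R2 b2 c2"
proof -
  have l: "linear R1" "linear R2" using R1 R2 orthogonal_transformation_linear by auto
  then have bl: "bounded_linear R1" "bounded_linear R2" using linear_conv_bounded_linear by auto
  have eT: "R1 (fst v) = R2 (fst v)" if q: "q \<in> M \<inter> W" and v: "v \<in> T q" for q v
  proof (rule tangent_derivative_cong[OF W(1) q v])
    show "((\<lambda>x. R1 (fst x) + b1) has_derivative (\<lambda>v. R1 (fst v))) (at q)"
      "((\<lambda>x. R2 (fst x) + b2) has_derivative (\<lambda>v. R2 (fst v))) (at q)"
      by (auto intro!: derivative_eq_intros bounded_linear.has_derivative[OF bl(1)] bounded_linear.has_derivative[OF bl(2)])
  qed (use eq in \<open>auto simp: rigid_motion_def\<close>)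
  have "R1 x = R2 x" for x
    by (rule linear_eq_on[OF l, of x "\<Union>q\<in>M \<inter> W. fst ` T q"])
      (use span_tangent_spaces[OF nonflat W] eT in auto)
  then have R: "R1 = R2" by blast
  have "rigid_motion R1 b1 c1 p = rigid_motion R2 b2 c2 p" using eq nonflat(2) W(2) by simp
  then show ?thesis using R by (auto simp: rigid_motion_def)
qed

lemma (in ph_transformation_extension) local_rigidity:
  assumes nonflat: "m = CARD('n) - 1" "p \<in> M" "\<not> flat_point M p" and p: "p \<in> U"
  shows "\<exists>R b c W. orthogonal_transformation R \<and> (\<forall>x. R (cJ x) = cJ (R x)) \<and> open W \<and> p \<in> W \<and>
     (\<forall>q\<in>M \<inter> W. \<phi> q = rigid_motion R b c q)"
proof -
  obtain W where W: "open W" "p \<in> W" "W \<subseteq> U" "M.holomorphically_connected W U"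
    using M.holomorphic_curves_in_submanifold[OF nonflat(2) open_U p] by blast
  have pW: "p \<in> M \<inter> W" using nonflat W by simp
  obtain R where R: "orthogonal_transformation R"
    and Rq: "\<And>q. q \<in> M \<inter> W \<Longrightarrow> fst (\<phi> q) - fst (\<phi> p) = R (fst q - fst p)"
    using isometric_families_congruent[OF pW, of "\<lambda>q. fst (\<phi> q)" fst] chord_isometry[OF W(4)]
      M.span_chords[OF nonflat W(1,2)] by blast
  have lR: "linear R" and ip: "\<And>x y. R x \<bullet> R y = x \<bullet> y"
    using R by (auto simp: orthogonal_transformation_def)
  have blR: "bounded_linear R" using lR linear_conv_bounded_linear by blast
  define b where "b = fst (\<phi> p) - R (fst p)"
  have fst_phi: "fst (\<phi> q) = R (fst q) + b" if "q \<in> M \<inter> W" for q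
    using Rq[OF that] by (simp add: b_def linear_diff[OF lR] algebra_simps)
  have Uq: "q \<in> M \<inter> U" if "q \<in> M \<inter> W" for q using that W(3) by blast
  \<comment> \<open>On tangent vectors \<open>R\<close> is the differential of
    \<open>\<phi>\<close>, so it inherits compatibility with \<open>cJ\<close> there, and by span
    everywhere. The real congruence thereby becomes unitary.\<close>
  have DF: "fst (DF q v) = R (fst v)" if q: "q \<in> M \<inter> W" and v: "v \<in> M.T q" for q v
  proof (rule tangent_derivative_cong[OF W(1) q v])
    show "((\<lambda>x. fst (F x)) has_derivative (\<lambda>v. fst (DF q v))) (at q)"
      using F_deriv Uq[OF q] has_derivative_fst by blast
    show "((\<lambda>x. R (fst x) + b) has_derivative (\<lambda>v. R (fst v))) (at q)"
      by (auto intro!: derivative_eq_intros bounded_linear.has_derivative[OF blR])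
    show "fst (F x) = R (fst x) + b" if "x \<in> M \<inter> W" for x
      using F_eq[OF Uq[OF that]] fst_phi[OF that] by simp
  qed
  have "R (cJ (fst v)) = cJ (R (fst v))" if q: "q \<in> M \<inter> W" and v: "v \<in> M.T q" for q v
  proof -
    have w: "(cJ (fst v), 0) \<in> M.T q" by (rule M.T_cJ[OF _ v]) (use q in auto)
    have "R (cJ (fst v)) = fst (DF q (cJ (fst v), 0))" using DF[OF q w] by simp
    also have "\<dots> = cJ (fst (DF q v))" by (rule fst_DF_cJ[OF Uq[OF q] v]) simp
    finally show ?thesis using DF[OF q v] by simp
  qed
  then have on_T: "(R \<circ> cJ) e = (cJ \<circ> R) e" if "e \<in> (\<Union>q\<in>M \<inter> W. fst ` M.T q)" for e
    using that by auto
  have "(R \<circ> cJ) x = (cJ \<circ> R) x" for x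
    by (rule linear_eq_on[OF linear_compose[OF linear_cJ lR] linear_compose[OF lR linear_cJ],
          of x "\<Union>q\<in>M \<inter> W. fst ` M.T q"])
      (use M.span_tangent_spaces[OF nonflat W(1,2)] on_T in auto)
  then have RJ: "R (cJ x) = cJ (R x)" for x by (simp add: o_def)
  \<comment> \<open>The discrepancy between the \<open>t\<close>-component of \<open>F\<close> and
    that of the motion with \<open>c = 0\<close>; it has to be constant along
    \<open>M\<close>.\<close>
  define h where "h q = snd (F q) - snd q + cJ b \<bullet> R (fst q)" for q
  \<comment> \<open>A second shrinking: the connecting curves must stay inside \<open>W\<close>,
    where the \<open>C^n\<close> part of \<open>\<phi>\<close> is already known.\<close>
  obtain W' where W': "open W'" "p \<in> W'" "W' \<subseteq> W" "M.holomorphically_connected W' W"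
    using M.holomorphic_curves_in_submanifold[OF nonflat(2) W(1,2)] by blast
  have h_const: "h q = h p" if "q \<in> M \<inter> W'" for q
  proof (rule M.constant_if_tangential_derivative_zero[OF W'(4) that])
    show "p \<in> M \<inter> W'" using W' nonflat by simp
    fix q assume q: "q \<in> M \<inter> W"
    let ?h' = "\<lambda>q v. snd (DF q v) - snd v + cJ b \<bullet> R (fst v)"
    show "(h has_derivative ?h' q) (at q)"
      unfolding h_def using F_deriv[of q] Uq[OF q]
      by (auto intro!: derivative_eq_intros bounded_linear.has_derivative[OF blR])
    fix v assume v: "v \<in> M.T q"
    \<comment> \<open>With the \<open>C^n\<close> part given by \<open>R\<close> and
      \<open>b\<close>, and \<open>R\<close> unitary, the terms containing \<open>fst q\<close>
      cancel; what remains of the equality of the two contact forms is exactly the vanishing of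
      \<open>?h' q v\<close>.\<close>
    have "Theta (\<phi> q) (DF q v) = Theta q v" using Theta_DF[OF Uq[OF q] v] .
    then show "?h' q v = 0"
      by (simp add: Theta_cJ fst_phi[OF q] DF[OF q v] linear_add[OF linear_cJ] inner_add_left RJ[symmetric] ip)
  qed
  have "\<phi> q = rigid_motion R b (h p) q" if q: "q \<in> M \<inter> W'" for q
  proof -
    have qW: "q \<in> M \<inter> W" using q W'(3) by blast
    have "snd (\<phi> q) = snd q + h p - cJ b \<bullet> R (fst q)"
      using h_const[OF q] F_eq[OF Uq[OF qW]] by (simp add: h_def)
    then show ?thesis using fst_phi[OF qW] by (simp add: rigid_motion_def prod_eq_iff)
  qed
  then show ?thesis using R RJ W'(1,2) by blast
qed

lemma (in ph_transformation_vertical) rigidity: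
  assumes m: "m = CARD('n) - 1" and nonflat: "\<And>p. p \<in> M \<Longrightarrow> \<not> flat_point M p" and conn: "connected M"
  shows "\<exists>\<Phi>\<in>PSH. \<forall>q\<in>M. \<phi> q = \<Phi> q"
proof (cases "M = {}")
  case True
  have "rigid_motion (\<lambda>x. x) 0 0 \<in> (PSH :: ('n heis \<Rightarrow> 'n heis) set)"
    by (rule rigid_motion_PSH) auto
  then show ?thesis using True by blast
next
  case False
  \<comment> \<open>The local motions are collected in their explicit form because uniqueness is
    proved for that form, not for arbitrary elements of \<open>PSH\<close>.\<close>
  define K :: "('n heis \<Rightarrow> 'n heis) set"
    where "K = {rigid_motion R b c |R b c. orthogonal_transformation R \<and> (\<forall>x. R (cJ x) = cJ (R x))}"
  have K_PSH: "K \<subseteq> PSH" unfolding K_def using rigid_motion_PSH by blast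
  have "\<exists>\<Phi>. \<Phi> \<in> K \<and> (\<exists>W. open W \<and> p \<in> W \<and> (\<forall>q\<in>M \<inter> W. \<phi> q = \<Phi> q))" if p: "p \<in> M" for p
  proof -
    obtain U F where UF: "p \<in> U" "smooth_on U F" "\<And>q. q \<in> M \<inter> U \<Longrightarrow> F q = \<phi> q"
      using extension_exists[OF p] by blast
    then interpret ph_transformation_extension M N m \<phi> U F by unfold_locales auto
    show ?thesis using local_rigidity[OF m p nonflat[OF p] UF(1)] unfolding K_def by blast
  qed
  then have "\<forall>p\<in>M. \<exists>\<Phi>. \<Phi> \<in> K \<and> (\<exists>W. open W \<and> p \<in> W \<and> (\<forall>q\<in>M \<inter> W. \<phi> q = \<Phi> q))" by blast
  from bchoice[OF this] obtain \<Phi> where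
    \<Phi>: "\<forall>p\<in>M. \<Phi> p \<in> K \<and> (\<exists>W. open W \<and> p \<in> W \<and> (\<forall>q\<in>M \<inter> W. \<phi> q = \<Phi> p q))"
    by blast
  \<comment> \<open>The motion chosen at each point is locally constant: those chosen at
    \<open>p\<close> and at a nearby \<open>q\<close> both agree with \<open>\<phi>\<close> on a
    neighbourhood of \<open>q\<close> in \<open>M\<close>, and non-flatness at \<open>q\<close>
    makes them equal as global maps.\<close>
  have loc: "\<exists>W. open W \<and> p \<in> W \<and> (\<forall>q\<in>M \<inter> W. \<Phi> p = \<Phi> q)" if p: "p \<in> M" for p
  proof -
    obtain W where W: "open W" "p \<in> W" "\<forall>q\<in>M \<inter> W. \<phi> q = \<Phi> p q" using \<Phi> p by blast
    have "\<Phi> p = \<Phi> q" if q: "q \<in> M \<inter> W" for q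
    proof -
      have qM: "q \<in> M" using q by simp
      obtain V where V: "open V" "q \<in> V" "\<forall>x\<in>M \<inter> V. \<phi> x = \<Phi> q x" using \<Phi> qM by blast
      obtain R1 b1 c1 where 1: "\<Phi> p = rigid_motion R1 b1 c1" "orthogonal_transformation R1"
        using \<Phi> p unfolding K_def by blast
      obtain R2 b2 c2 where 2: "\<Phi> q = rigid_motion R2 b2 c2" "orthogonal_transformation R2"
        using \<Phi> qM unfolding K_def by blast
      have eq: "rigid_motion R1 b1 c1 x = rigid_motion R2 b2 c2 x" if "x \<in> M \<inter> (W \<inter> V)" for x
      proof -
        have "x \<in> M \<inter> W" "x \<in> M \<inter> V" using that by auto
        then have "\<Phi> p x = \<Phi> q x" using bspec[OF W(3), of x] bspec[OF V(3), of x] by simp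
        then show ?thesis using 1(1) 2(1) by simp
      qed
      have "open (W \<inter> V)" "q \<in> W \<inter> V" using W V q by auto
      from M.rigid_motion_unique[OF m qM nonflat[OF qM] this 1(2) 2(2) eq]
      show ?thesis using 1(1) 2(1) by simp
    qed
    then show ?thesis using W by blast
  qed
  obtain p0 where p0: "p0 \<in> M" using False by blast
  have const: "\<Phi> p0 = \<Phi> q" if q: "q \<in> M" for q
  proof (rule connected_local_const[OF conn p0 q, where f = \<Phi>])
    show "\<forall>a\<in>M. \<forall>\<^sub>F b in at a within M. \<Phi> a = \<Phi> b"
    proof
      fix a assume "a \<in> M"
      then obtain W where W: "open W" "a \<in> W" "\<forall>q\<in>M \<inter> W. \<Phi> a = \<Phi> q" using loc by blast
      have "\<forall>\<^sub>F b in at a within M. b \<in> W \<inter> M"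
        unfolding eventually_at_topological using W(1,2) by blast
      then show "\<forall>\<^sub>F b in at a within M. \<Phi> a = \<Phi> b"
        by eventually_elim (use W(3) in blast)
    qed
  qed
  have "\<phi> q = \<Phi> p0 q" if q: "q \<in> M" for q
  proof -
    have "\<phi> q = \<Phi> q q" using \<Phi> q by blast
    then show ?thesis using const[OF q] by simp
  qed
  moreover have "\<Phi> p0 \<in> PSH" using \<Phi> p0 K_PSH by blast
  ultimately show ?thesis by blast
qed

theorem theorem7p2:
  fixes M N :: "('n::finite) heis set" and \<phi> :: "'n heis \<Rightarrow> 'n heis"
  assumes "ph_submanifold (CARD('n) - 1) M" and "ph_submanifold (CARD('n) - 1) N"
    and "vertical M" and "vertical N"
    and "simply_connected M" and "simply_connected N"
    and "\<forall>p\<in>M. \<not> flat_point M p" and "\<forall>p\<in>N. \<not> flat_point N p"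
    and "ph_transformation M N \<phi>"
  shows "\<exists>\<Phi>\<in>PSH. \<forall>q\<in>M. \<phi> q = \<Phi> q"
proof -
  interpret ph_transformation_vertical M N "CARD('n) - 1" \<phi>
    by unfold_locales (use assms in auto)
  show ?thesis
    by (rule rigidity) (use assms simply_connected_imp_connected in auto)
qed

end
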